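(* Let $A$ be a finite-dimensional algebra over $\mathbb{C}$ and let $n\geq2$. For every $f\in\mathcal F_n$, the algebra $A$ admits an invertible local $f$-Leibniz derivation if and only if it admits an invertible $f$-Leibniz derivation. In particular, the same equivalence holds with the same order $n$ for left Leibniz derivations, right Leibniz derivations and Leibniz derivations: $A$ admits an invertible local left Leibniz derivation (respectively local right Leibniz derivation, local Leibniz derivation) of order $n$ if and only if it admits an invertible left Leibniz derivation (respectively right Leibniz derivation, Leibniz derivation) of order $n$. It also holds for each of these three notions without a prescribed order: $\operatorname{LocLDer}_{l}(A)$ (respectively $\operatorname{LocLDer}_{r}(A)$, $\operatorname{LocLDer}(A)$) contains an invertible map if and only if $\operatorname{LDer}_{l}(A)$ (respectively $\operatorname{LDer}_{r}(A)$, $\operatorname{LDer}(A)$) contains an invertible map.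
   Context: An algebra is a finite-dimensional vector space over $\mathbb{C}$ equipped with a single bilinear multiplication (no further identities assumed). For $n\ge 2$, $\mathcal F_n$ is the set of all arrangements of brackets in a product of length $n$; for $f\in\mathcal F_n$, $[x_1,\ldots,x_n]_f$ denotes the product of $x_1,\ldots,x_n$ (in this order) bracketed according to $f$. A linear map $D\in\operatorname{End}(A)$ is an $f$-Leibniz derivation if $D([x_1,\ldots,x_n]_f)=\sum_{i=1}^{n}[x_1,\ldots,D(x_i),\ldots,x_n]_f$ for all $x_1,\ldots,x_n\in A$; the space of these is $\operatorname{LDer}_f(A)$. The left and right arrangements of length $n$ are $[x_1,\ldots,x_n]_{l(n)}=(\cdots((x_1x_2)x_3)\cdots)x_n$ and $[x_1,\ldots,x_n]_{r(n)}=x_1(x_2(\cdots(x_{n-1}x_n)\cdots))$; the corresponding $f$-Leibniz derivations are called left, respectively right, Leibniz derivations of order $n$, with spaces $\operatorname{LDer}_{l(n)}(A)$ and $\operatorname{LDer}_{r(n)}(A)$. A Leibniz derivation of order $n$ is a linear map that is an $f$-Leibniz derivation for every $f\in\mathcal F_n$; $\operatorname{LDer}_n(A)=\bigcap_{f\in\mathcal F_n}\operatorname{LDer}_f(A)$. Set $\operatorname{LDer}(A)=\bigcup_{n\ge2}\operatorname{LDer}_n(A)$, $\operatorname{LDer}_l(A)=\bigcup_{n\ge2}\operatorname{LDer}_{l(n)}(A)$, $\operatorname{LDer}_r(A)=\bigcup_{n\ge2}\operatorname{LDer}_{r(n)}(A)$. A linear map $\Delta\in\operatorname{End}(A)$ is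 a local $f$-Leibniz derivation if for every $x\in A$ there exists $D_x\in\operatorname{LDer}_f(A)$ with $\Delta(x)=D_x(x)$; the set of these is $\operatorname{LocLDer}_f(A)$. For $f=l(n)$ and $f=r(n)$ these are called local left, respectively local right, Leibniz derivations of order $n$, with sets $\operatorname{LocLDer}_{l(n)}(A)$ and $\operatorname{LocLDer}_{r(n)}(A)$. A local Leibniz derivation of order $n$ is a linear map $\Delta$ such that for every $x\in A$ there exists $D_x\in\operatorname{LDer}_n(A)$ with $\Delta(x)=D_x(x)$; the set of these is $\operatorname{LocLDer}_n(A)$. Set $\operatorname{LocLDer}(A)=\bigcup_{n\ge2}\operatorname{LocLDer}_n(A)$, $\operatorname{LocLDer}_l(A)=\bigcup_{n\ge2}\operatorname{LocLDer}_{l(n)}(A)$, $\operatorname{LocLDer}_r(A)=\bigcup_{n\ge2}\operatorname{LocLDer}_{r(n)}(A)$. In each local definition the order $n$, and the arrangement $f$ when specified, are fixed and do not depend on $x$. Invertible means invertible as a linear map $A\to A$. *)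

theory Defs
  imports Complex_Main
begin

text \<open>The whole type \<open>'a\<close> is the underlying space of the algebra, with scalar action
  \<open>smul\<close> and multiplication \<open>mult\<close>. The zero algebra is not excluded.\<close>

definition fin_dim_complex_algebra ::
    "(complex \<Rightarrow> 'a::ab_group_add \<Rightarrow> 'a) \<Rightarrow> ('a \<Rightarrow> 'a \<Rightarrow> 'a) \<Rightarrow> bool" where
  "fin_dim_complex_algebra smul mult \<longleftrightarrow>
     (\<exists>B. finite_dimensional_vector_space smul B) \<and>
     (\<forall>x. Vector_Spaces.linear smul smul (\<lambda>y. mult x y)) \<and>
     (\<forall>y. Vector_Spaces.linear smul smul (\<lambda>x. mult x y))"

text \<open>An arrangement of brackets is a full binary tree whose leaves, read from left to right,
  are the positions of the factors.\<close>

datatype bracketing = Slot | Br bracketing bracketing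

primrec slots :: "bracketing \<Rightarrow> nat" where
  "slots Slot = 1"
| "slots (Br f g) = slots f + slots g"

definition arrangements :: "nat \<Rightarrow> bracketing set" where
  "arrangements n = {f. slots f = n}"

text \<open>\<open>bracket mult f [x\<^sub>1, \<dots>, x\<^sub>n]\<close> is the product of
  \<open>x\<^sub>1, \<dots>, x\<^sub>n\<close> bracketed according to \<open>f\<close>; it is meaningful only for lists of
  length \<open>slots f\<close>.\<close>

primrec bracket :: "('a \<Rightarrow> 'a \<Rightarrow> 'a) \<Rightarrow> bracketing \<Rightarrow> 'a list \<Rightarrow> 'a" where
  "bracket mult Slot xs = hd xs"
| "bracket mult (Br f g) xs =
     mult (bracket mult f (take (slots f) xs)) (bracket mult g (drop (slots f) xs))"

text \<open>The value at length \<open>0\<close> is a dummy.\<close>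

fun left_arrangement :: "nat \<Rightarrow> bracketing" where
  "left_arrangement 0 = Slot"
| "left_arrangement (Suc 0) = Slot"
| "left_arrangement (Suc (Suc n)) = Br (left_arrangement (Suc n)) Slot"

fun right_arrangement :: "nat \<Rightarrow> bracketing" where
  "right_arrangement 0 = Slot"
| "right_arrangement (Suc 0) = Slot"
| "right_arrangement (Suc (Suc n)) = Br Slot (right_arrangement (Suc n))"

lemma slots_left_arrangement: "n \<ge> 1 \<Longrightarrow> slots (left_arrangement n) = n"
  by (induction n rule: left_arrangement.induct) auto

lemma slots_right_arrangement: "n \<ge> 1 \<Longrightarrow> slots (right_arrangement n) = n"
  by (induction n rule: right_arrangement.induct) auto

lemma bracket_left_arrangement:
  "bracket mult (left_arrangement (Suc (length xs))) (x # xs) = foldl mult x xs"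
proof (induction xs rule: rev_induct)
  case (snoc y ys)
  have "slots (left_arrangement (Suc (length ys))) = Suc (length ys)"
    by (simp add: slots_left_arrangement)
  with snoc show ?case by simp
qed simp

lemma bracket_right_arrangement:
  "bracket mult (right_arrangement (Suc (length xs))) (xs @ [x]) = foldr mult xs x"
  by (induction xs) auto

definition LDer_arr ::
    "(complex \<Rightarrow> 'a::ab_group_add \<Rightarrow> 'a) \<Rightarrow> ('a \<Rightarrow> 'a \<Rightarrow> 'a) \<Rightarrow> bracketing \<Rightarrow> ('a \<Rightarrow> 'a) set" where
  "LDer_arr smul mult f =
     {D. Vector_Spaces.linear smul smul D \<and>
         (\<forall>xs. length xs = slots f \<longrightarrow>
            D (bracket mult f xs) = (\<Sum>i<slots f. bracket mult f (xs[i := D (xs ! i)])))}"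

definition LDer_ord ::
    "(complex \<Rightarrow> 'a::ab_group_add \<Rightarrow> 'a) \<Rightarrow> ('a \<Rightarrow> 'a \<Rightarrow> 'a) \<Rightarrow> nat \<Rightarrow> ('a \<Rightarrow> 'a) set" where
  "LDer_ord smul mult n = (\<Inter>f\<in>arrangements n. LDer_arr smul mult f)"

definition LDer ::
    "(complex \<Rightarrow> 'a::ab_group_add \<Rightarrow> 'a) \<Rightarrow> ('a \<Rightarrow> 'a \<Rightarrow> 'a) \<Rightarrow> ('a \<Rightarrow> 'a) set" where
  "LDer smul mult = (\<Union>n\<in>{2..}. LDer_ord smul mult n)"

definition LDer_left ::
    "(complex \<Rightarrow> 'a::ab_group_add \<Rightarrow> 'a) \<Rightarrow> ('a \<Rightarrow> 'a \<Rightarrow> 'a) \<Rightarrow> ('a \<Rightarrow> 'a) set" where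
  "LDer_left smul mult = (\<Union>n\<in>{2..}. LDer_arr smul mult (left_arrangement n))"

definition LDer_right ::
    "(complex \<Rightarrow> 'a::ab_group_add \<Rightarrow> 'a) \<Rightarrow> ('a \<Rightarrow> 'a \<Rightarrow> 'a) \<Rightarrow> ('a \<Rightarrow> 'a) set" where
  "LDer_right smul mult = (\<Union>n\<in>{2..}. LDer_arr smul mult (right_arrangement n))"

definition local_maps ::
    "(complex \<Rightarrow> 'a::ab_group_add \<Rightarrow> 'a) \<Rightarrow> ('a \<Rightarrow> 'a) set \<Rightarrow> ('a \<Rightarrow> 'a) set" where
  "local_maps smul S =
     {\<Delta>. Vector_Spaces.linear smul smul \<Delta> \<and> (\<forall>x. \<exists>D\<in>S. \<Delta> x = D x)}"

definition LocLDer_arr ::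
    "(complex \<Rightarrow> 'a::ab_group_add \<Rightarrow> 'a) \<Rightarrow> ('a \<Rightarrow> 'a \<Rightarrow> 'a) \<Rightarrow> bracketing \<Rightarrow> ('a \<Rightarrow> 'a) set" where
  "LocLDer_arr smul mult f = local_maps smul (LDer_arr smul mult f)"

definition LocLDer_ord ::
    "(complex \<Rightarrow> 'a::ab_group_add \<Rightarrow> 'a) \<Rightarrow> ('a \<Rightarrow> 'a \<Rightarrow> 'a) \<Rightarrow> nat \<Rightarrow> ('a \<Rightarrow> 'a) set" where
  "LocLDer_ord smul mult n = local_maps smul (LDer_ord smul mult n)"

text \<open>The order is chosen before the point: these are unions of sets of local maps, not the
  local maps of a union.\<close>

definition LocLDer ::
    "(complex \<Rightarrow> 'a::ab_group_add \<Rightarrow> 'a) \<Rightarrow> ('a \<Rightarrow> 'a \<Rightarrow> 'a) \<Rightarrow> ('a \<Rightarrow> 'a) set" where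
  "LocLDer smul mult = (\<Union>n\<in>{2..}. LocLDer_ord smul mult n)"

definition LocLDer_left ::
    "(complex \<Rightarrow> 'a::ab_group_add \<Rightarrow> 'a) \<Rightarrow> ('a \<Rightarrow> 'a \<Rightarrow> 'a) \<Rightarrow> ('a \<Rightarrow> 'a) set" where
  "LocLDer_left smul mult = (\<Union>n\<in>{2..}. LocLDer_arr smul mult (left_arrangement n))"

definition LocLDer_right ::
    "(complex \<Rightarrow> 'a::ab_group_add \<Rightarrow> 'a) \<Rightarrow> ('a \<Rightarrow> 'a \<Rightarrow> 'a) \<Rightarrow> ('a \<Rightarrow> 'a) set" where
  "LocLDer_right smul mult = (\<Union>n\<in>{2..}. LocLDer_arr smul mult (right_arrangement n))"

definition invertible_linear ::
    "(complex \<Rightarrow> 'a::ab_group_add \<Rightarrow> 'a) \<Rightarrow> ('a \<Rightarrow> 'a) \<Rightarrow> bool" where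
  "invertible_linear smul D \<longleftrightarrow>
     Vector_Spaces.linear smul smul D \<and>
     (\<exists>E. Vector_Spaces.linear smul smul E \<and> E \<circ> D = id \<and> D \<circ> E = id)"

end

theory Submission
  imports Defs "HOL-Computational_Algebra.Computational_Algebra"
begin

text \<open>
  The Leibniz derivations form a Lie algebra \<open>L\<close> of linear maps, and for such an \<open>L\<close> we show: if
  \<open>\<Delta>\<close> is linear, invertible, and \<open>\<Delta> x \<in> L x\<close> for all \<open>x\<close>, then \<open>L\<close> contains an invertible map.
  Suppose not. Choose \<open>h \<in> L\<close> whose generalised null space \<open>V\<^sub>0\<close> has least dimension; it is nonzero.
  By minimality the null component \<open>L\<^sub>0\<close> of \<open>ad h\<close> acts on \<open>V\<^sub>0\<close> by nilpotent maps, so Engel's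
  theorem gives \<open>x \<noteq> 0\<close> in \<open>V\<^sub>0\<close> killed by \<open>L\<^sub>0\<close>. Hence \<open>h\<close>, viewed as a vector field on the orbit
  of \<open>x\<close> under the group of \<open>L\<close>, has a nondegenerate zero at \<open>x\<close>. Since \<open>\<Delta>\<close> is tangent to that orbit,
  the zero persists for \<open>h + t \<Delta>\<close>: there is a formal solution \<open>y\<^sub>0 + t y\<^sub>1 + \<dots>\<close> of
  \<open>(h + t \<Delta>) y = 0\<close> with \<open>y\<^sub>0 = x\<close>. Then \<open>\<Delta>\<^sup>-\<^sup>1 h\<close> maps \<open>y\<^sub>k\<^sub>+\<^sub>1\<close> to \<open>- y\<^sub>k\<close> and \<open>y\<^sub>0\<close> to \<open>0\<close>,
  which is impossible in finite dimension.
\<close>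

section \<open>Complex vector spaces and generalised eigenvectors\<close>

locale complex_vector_space = vector_space scale
  for scale :: "complex \<Rightarrow> 'b::ab_group_add \<Rightarrow> 'b" (infixr "*s" 75)
begin

lemma linear_zero: "Vector_Spaces.linear scale scale T \<Longrightarrow> T 0 = 0"
  by (simp add: linear_iff_module_hom module_hom.zero)

lemma linearD:
  assumes "Vector_Spaces.linear scale scale T"
  shows "T (x + y) = T x + T y" "T (x - y) = T x - T y" "T (c *s x) = c *s T x" "T (- x) = - T x"
    "T (sum f I) = (\<Sum>i\<in>I. T (f i))"
  using assms
  by (simp_all add: linear_iff_module_hom module_hom.add module_hom.diff module_hom.scale
      module_hom.neg module_hom.sum)

lemma linear_funpow:
  assumes "Vector_Spaces.linear scale scale T"
  shows "Vector_Spaces.linear scale scale (T ^^ k)"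
proof (induction k)
  case 0
  show ?case by (simp add: Vector_Spaces.linear_iff vector_space_axioms)
next
  case (Suc k)
  with assms show ?case by (simp add: Vector_Spaces.linear_iff)
qed

lemma linear_shift:
  assumes "Vector_Spaces.linear scale scale T"
  shows "Vector_Spaces.linear scale scale (\<lambda>y. T y - c *s y)"
  using assms by (simp add: Vector_Spaces.linear_iff algebra_simps)

lemma funpow_zero_mono:
  assumes "Vector_Spaces.linear scale scale T" "(T ^^ k) x = 0" "k \<le> l"
  shows "(T ^^ l) x = 0"
proof -
  have "(T ^^ l) x = (T ^^ (l - k)) ((T ^^ k) x)"
    using assms(3) by (simp flip: funpow_add comp_apply[of "T ^^ (l - k)"])
  then show ?thesis using assms linear_zero[OF linear_funpow] by simp
qed

lemma funpow_mem: "x \<in> S \<Longrightarrow> (\<And>y. y \<in> S \<Longrightarrow> T y \<in> S) \<Longrightarrow> (T ^^ k) x \<in> S"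
  by (induction k) auto

text \<open>Sampling at powers of two makes the induction work: \<open>f (2 * t) - 2 ^ n * f t\<close> kills the
  leading coefficient.\<close>

lemma coefficients_in_subspace:
  assumes W: "subspace W"
    and "\<And>k. k \<ge> k0 \<Longrightarrow> (\<Sum>i\<le>n. (2 ^ k) ^ i *s c i) \<in> W"
    and "i \<le> n"
  shows "c i \<in> W"
  using assms(2,3)
proof (induction n arbitrary: c i)
  case 0
  then show ?case by force
next
  case (Suc n)
  have unscale: "x \<in> W" if "a *s x \<in> W" "a \<noteq> 0" for a x
    using subspace_scale[OF W that(1), of "inverse a"] that(2) by simp
  have low: "c i \<in> W" if "i \<le> n" for i
  proof -
    have "(\<Sum>i\<le>n. (2 ^ k) ^ i *s ((2 ^ i - 2 ^ Suc n) *s c i)) \<in> W" if "k \<ge> k0" for k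
    proof -
      have "(\<Sum>i\<le>Suc n. (2 ^ Suc k) ^ i *s c i)
          - 2 ^ Suc n *s (\<Sum>i\<le>Suc n. (2 ^ k) ^ i *s c i) \<in> W"
        using that by (intro subspace_diff[OF W] subspace_scale[OF W] Suc.prems(1)) auto
      also have "(\<Sum>i\<le>Suc n. (2 ^ Suc k) ^ i *s c i)
          - 2 ^ Suc n *s (\<Sum>i\<le>Suc n. (2 ^ k) ^ i *s c i)
          = (\<Sum>i\<le>Suc n. (2 ^ k) ^ i *s ((2 ^ i - 2 ^ Suc n) *s c i))"
        unfolding scale_sum_right sum_subtractf[symmetric]
        by (rule sum.cong) (auto simp: power_mult_distrib algebra_simps)
      finally show ?thesis by simp
    qed
    then have "(2 ^ i - 2 ^ Suc n) *s c i \<in> W"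
      using Suc.IH[of "\<lambda>i. (2 ^ i - 2 ^ Suc n) *s c i" i] that by blast
    moreover have "(2::complex) ^ i - 2 ^ Suc n \<noteq> 0"
    proof -
      have "(2::nat) ^ i \<noteq> 2 ^ Suc n" using that by (subst power_inject_exp) auto
      then have "of_nat (2 ^ i) \<noteq> (of_nat (2 ^ Suc n) :: complex)" by (simp only: of_nat_eq_iff) simp
      then show ?thesis by simp
    qed
    ultimately show ?thesis using unscale by blast
  qed
  show ?case
  proof (cases "i \<le> n")
    case False
    have "(\<Sum>i\<le>Suc n. (2 ^ k0) ^ i *s c i) - (\<Sum>i\<le>n. (2 ^ k0) ^ i *s c i) \<in> W"
      using low by (intro subspace_diff[OF W] subspace_sum[OF W] subspace_scale[OF W] Suc.prems(1)) auto
    then have "(2 ^ k0) ^ Suc n *s c (Suc n) \<in> W" by simp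
    then have "c (Suc n) \<in> W" by (rule unscale) simp
    with False Suc.prems(2) show ?thesis by (simp add: le_Suc_eq)
  qed (use low in auto)
qed

lemma span_image_lessThan:
  fixes k :: nat
  assumes "x \<in> span (v ` {..<k})"
  shows "\<exists>c. x = (\<Sum>i<k. c i *s v i)"
proof -
  define U where "U = {x. \<exists>c. x = (\<Sum>i<k. c i *s v i)}"
  have "subspace U"
  proof (rule subspaceI)
    show "0 \<in> U" unfolding U_def by (auto intro!: exI[of _ "\<lambda>_. 0"])
  next
    fix x y assume "x \<in> U" "y \<in> U"
    then obtain c d where "x = (\<Sum>i<k. c i *s v i)" "y = (\<Sum>i<k. d i *s v i)"
      by (auto simp: U_def)
    then have "x + y = (\<Sum>i<k. (c i + d i) *s v i)"
      by (simp add: scale_left_distrib sum.distrib)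
    then show "x + y \<in> U" unfolding U_def by (intro CollectI exI)
  next
    fix a x assume "x \<in> U"
    then obtain c where "x = (\<Sum>i<k. c i *s v i)" by (auto simp: U_def)
    then have "a *s x = (\<Sum>i<k. (a * c i) *s v i)" by (simp add: scale_sum_right)
    then show "a *s x \<in> U" unfolding U_def by (intro CollectI exI)
  qed
  moreover have "v j \<in> U" if "j < k" for j
  proof -
    have "(\<Sum>i<k. (if i = j then 1 else 0) *s v i) = (\<Sum>i<k. if i = j then v i else 0)"
      by (rule sum.cong) auto
    also have "\<dots> = v j" using that by simp
    finally have "v j = (\<Sum>i<k. (if i = j then 1 else 0) *s v i)" by simp
    then show ?thesis unfolding U_def by (intro CollectI exI)
  qed
  ultimately have "span (v ` {..<k}) \<subseteq> U" by (intro span_minimal) auto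
  with assms show ?thesis by (auto simp: U_def)
qed

text \<open>A family in which each vector avoids the span of its predecessors is independent. Most
  finiteness arguments below reduce to this bound, for vectors as well as for operators.\<close>

lemma no_long_chain:
  assumes "finite F" "\<And>k. k < N \<Longrightarrow> v k \<in> span F" "\<And>k. k < N \<Longrightarrow> v k \<notin> span (v ` {..<k})"
  shows "N \<le> card F"
proof -
  have "independent (v ` {..<k}) \<and> card (v ` {..<k}) = k" if "k \<le> N" for k
    using that
  proof (induction k)
    case 0
    show ?case by (simp add: dependent_def)
  next
    case (Suc k)
    have eq: "v ` {..<Suc k} = insert (v k) (v ` {..<k})" by (simp add: lessThan_Suc)
    have "v k \<notin> v ` {..<k}" using assms(3)[of k] Suc.prems span_base by (meson Suc_le_lessD)
    then show ?case using Suc assms(3)[of k] unfolding eq by (simp add: independent_insertI)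
  qed
  from this[of N] show ?thesis
    using independent_span_bound[OF assms(1), of "v ` {..<N}"] assms(2) by auto
qed

text \<open>The exponent is left free because the same notion is applied to
  \<open>commutator h\<close> on all additive endomorphisms, a space with no dimension bound at
  hand.\<close>

definition gen_eig :: "('b \<Rightarrow> 'b) \<Rightarrow> complex \<Rightarrow> 'b set" where
  "gen_eig T c = {x. \<exists>k. ((\<lambda>y. T y - c *s y) ^^ k) x = 0}"

lemma gen_eigI: "((\<lambda>y. T y - c *s y) ^^ k) x = 0 \<Longrightarrow> x \<in> gen_eig T c"
  by (auto simp: gen_eig_def)

lemma gen_eig_0_iff: "x \<in> gen_eig T 0 \<longleftrightarrow> (\<exists>k. (T ^^ k) x = 0)"
  by (simp add: gen_eig_def)

lemma subspace_gen_eig: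
  assumes T: "Vector_Spaces.linear scale scale T"
  shows "subspace (gen_eig T c)"
proof -
  define S where "S = (\<lambda>y. T y - c *s y)"
  have S: "Vector_Spaces.linear scale scale S" unfolding S_def by (rule linear_shift[OF T])
  show ?thesis
  proof (rule subspaceI)
    show "0 \<in> gen_eig T c" by (rule gen_eigI[where k = 0]) simp
  next
    fix x y assume "x \<in> gen_eig T c" "y \<in> gen_eig T c"
    then obtain k l where "(S ^^ k) x = 0" "(S ^^ l) y = 0" by (auto simp: gen_eig_def S_def)
    then have "(S ^^ (k + l)) x = 0" "(S ^^ (k + l)) y = 0"
      using funpow_zero_mono[OF S] by auto
    then have "(S ^^ (k + l)) (x + y) = 0" using linearD(1)[OF linear_funpow[OF S]] by simp
    then show "x + y \<in> gen_eig T c" unfolding S_def by (rule gen_eigI)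
  next
    fix a x assume "x \<in> gen_eig T c"
    then obtain k where "(S ^^ k) x = 0" by (auto simp: gen_eig_def S_def)
    then have "(S ^^ k) (a *s x) = 0" using linearD(3)[OF linear_funpow[OF S]] by simp
    then show "a *s x \<in> gen_eig T c" unfolding S_def by (rule gen_eigI)
  qed
qed

lemma gen_eig_invariant:
  assumes T: "Vector_Spaces.linear scale scale T" and "x \<in> gen_eig T c"
  shows "T x \<in> gen_eig T c"
proof -
  define S where "S = (\<lambda>y. T y - c *s y)"
  obtain k where k: "(S ^^ k) x = 0" using assms(2) by (auto simp: gen_eig_def S_def)
  have "S 0 = 0" using linear_zero[OF linear_shift[OF T]] by (simp add: S_def)
  then have "(S ^^ k) (S x) = 0" using k funpow_swap1[of S k x] by simp
  then have "S x \<in> gen_eig T c" unfolding S_def by (rule gen_eigI)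
  then have "S x + c *s x \<in> gen_eig T c"
    by (intro subspace_add[OF subspace_gen_eig[OF T]] subspace_scale[OF subspace_gen_eig[OF T]] assms(2))
  then show ?thesis by (simp add: S_def)
qed

lemma gen_eig_eigenvector:
  assumes "x \<in> gen_eig T c" "x \<noteq> 0"
  obtains u where "u \<noteq> 0" "T u = c *s u"
proof -
  define S where "S = (\<lambda>y. T y - c *s y)"
  define k where "k = (LEAST k. (S ^^ k) x = 0)"
  have ex: "\<exists>k. (S ^^ k) x = 0" using assms(1) by (auto simp: gen_eig_def S_def)
  have k: "(S ^^ k) x = 0" unfolding k_def by (rule LeastI_ex[OF ex])
  with assms(2) obtain j where j: "k = Suc j" by (cases k) auto
  then have "(S ^^ j) x \<noteq> 0" using not_less_Least[of j "\<lambda>k. (S ^^ k) x = 0"] by (simp add: k_def)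
  moreover have "S ((S ^^ j) x) = 0" using k j by simp
  ultimately show ?thesis using that by (simp add: S_def)
qed

text \<open>With \<open>Q\<close> the shift of \<open>T\<close> by \<open>\<mu>\<close>, the
  operator \<open>T - \<nu>\<close> is \<open>Q + (\<mu> - \<nu>)\<close>, where \<open>Q\<close> is
  nilpotent at \<open>x\<close> and the scalar is invertible; the induction unfolds the geometric
  series. The invariant subspace \<open>S\<close> is carried along so that solutions can be found
  inside a Lie algebra.\<close>

lemma gen_eig_shift_surj:
  assumes T: "Vector_Spaces.linear scale scale T" and S: "subspace S" "\<And>y. y \<in> S \<Longrightarrow> T y \<in> S"
    and x: "x \<in> S" "x \<in> gen_eig T \<mu>" and "\<mu> \<noteq> \<nu>"
  shows "\<exists>u\<in>S \<inter> gen_eig T \<mu>. T u - \<nu> *s u = x"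
proof -
  define Q where "Q = (\<lambda>y. T y - \<mu> *s y)"
  obtain k where "(Q ^^ k) x = 0" using x(2) by (auto simp: gen_eig_def Q_def)
  then show ?thesis using x
  proof (induction k arbitrary: x)
    case 0
    then have "T 0 - \<nu> *s 0 = x" using linear_zero[OF T] by simp
    moreover have "0 \<in> S \<inter> gen_eig T \<mu>" using subspace_0 S(1) subspace_gen_eig[OF T] by blast
    ultimately show ?case by blast
  next
    case (Suc k)
    have "Q x \<in> S" unfolding Q_def
      using Suc.prems S by (intro subspace_diff[OF S(1)] subspace_scale[OF S(1)]) auto
    moreover have "Q x \<in> gen_eig T \<mu>" unfolding Q_def
      using Suc.prems gen_eig_invariant[OF T] subspace_gen_eig[OF T]
      by (intro subspace_diff subspace_scale) auto
    moreover have "(Q ^^ k) (Q x) = 0" using Suc.prems(1) by (simp add: funpow_swap1)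
    ultimately obtain u where u: "u \<in> S \<inter> gen_eig T \<mu>" "T u - \<nu> *s u = Q x"
      using Suc.IH by blast
    define w where "w = inverse (\<mu> - \<nu>) *s (x - u)"
    have "w \<in> S \<inter> gen_eig T \<mu>" unfolding w_def
      using u(1) Suc.prems S(1) subspace_gen_eig[OF T] by (auto intro!: subspace_scale subspace_diff)
    moreover have "T w - \<nu> *s w = x"
    proof -
      have "T w - \<nu> *s w = inverse (\<mu> - \<nu>) *s ((T x - \<nu> *s x) - (T u - \<nu> *s u))"
        unfolding w_def by (simp add: linearD[OF T] algebra_simps)
      also have "(T x - \<nu> *s x) - (T u - \<nu> *s u) = (\<mu> - \<nu>) *s x"
        unfolding u(2) Q_def by (simp add: algebra_simps)
      finally show ?thesis using assms(6) by simp
    qed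
    ultimately show ?case by blast
  qed
qed

section \<open>Polynomials in an operator and the generalised eigenspace decomposition\<close>

definition poly_op :: "complex poly \<Rightarrow> ('b \<Rightarrow> 'b) \<Rightarrow> 'b \<Rightarrow> 'b" where
  "poly_op p T w = (\<Sum>i\<le>degree p. coeff p i *s (T ^^ i) w)"

lemma poly_op_altdef:
  "degree p \<le> n \<Longrightarrow> poly_op p T w = (\<Sum>i\<le>n. coeff p i *s (T ^^ i) w)"
  unfolding poly_op_def by (rule sum.mono_neutral_left) (auto simp: coeff_eq_0)

lemma poly_op_linear_factor:
  assumes T: "Vector_Spaces.linear scale scale T"
  shows "poly_op ([:- c, 1:] * q) T w = poly_op q T (T w - c *s w)"
proof -
  define n where "n = degree q"
  have "degree ([:- c, 1:] * q) \<le> Suc n"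
    using degree_mult_le[of "[:- c, 1:]" q] by (simp add: n_def)
  then have "poly_op ([:- c, 1:] * q) T w = (\<Sum>i\<le>Suc n. coeff ([:- c, 1:] * q) i *s (T ^^ i) w)"
    by (rule poly_op_altdef)
  also have "\<dots> = (\<Sum>i\<le>Suc n. coeff (pCons 0 q) i *s (T ^^ i) w)
      - (\<Sum>i\<le>Suc n. (c * coeff q i) *s (T ^^ i) w)"
    unfolding sum_subtractf[symmetric] by (rule sum.cong) (auto simp: algebra_simps)
  also have "(\<Sum>i\<le>Suc n. coeff (pCons 0 q) i *s (T ^^ i) w)
      = (\<Sum>i\<le>n. coeff q i *s (T ^^ i) (T w))"
    by (subst sum.atMost_Suc_shift) (simp add: funpow_swap1)
  also have "(\<Sum>i\<le>Suc n. (c * coeff q i) *s (T ^^ i) w) = (\<Sum>i\<le>n. (c * coeff q i) *s (T ^^ i) w)"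
    by (simp add: n_def coeff_eq_0)
  also have "(\<Sum>i\<le>n. coeff q i *s (T ^^ i) (T w)) - \<dots> = poly_op q T (T w - c *s w)"
    unfolding poly_op_def n_def sum_subtractf[symmetric]
    by (rule sum.cong)
      (auto simp: linearD[OF linear_funpow[OF T]] scale_right_diff_distrib mult.commute)
  finally show ?thesis .
qed

text \<open>Strip a root \<open>c\<close> of \<open>p\<close>. By induction
  \<open>T w - c *s w\<close> is a combination of generalised eigenvectors; those for other
  eigenvalues have preimages under \<open>T - c\<close>, and removing the corresponding combination
  \<open>y\<close> from \<open>w\<close> leaves a generalised eigenvector for
  \<open>c\<close>.\<close>

lemma span_gen_eig_if_poly_op:
  assumes T: "Vector_Spaces.linear scale scale T" and S: "subspace S" "\<And>y. y \<in> S \<Longrightarrow> T y \<in> S"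
    and "w \<in> S" "p \<noteq> 0" "poly_op p T w = 0"
  shows "w \<in> span (S \<inter> (\<Union>c. gen_eig T c))"
  using assms(4-6)
proof (induction "degree p" arbitrary: p w)
  case 0
  then have "coeff p 0 *s w = 0" by (simp add: poly_op_def)
  moreover have "coeff p 0 \<noteq> 0" using 0 leading_coeff_0_iff[of p] by auto
  ultimately show ?case by (simp add: span_zero)
next
  case (Suc n)
  have "\<not> constant (poly p)" using Suc.hyps(2) constant_degree[of p] by simp
  then obtain c where "poly p c = 0" using fundamental_theorem_of_algebra by blast
  then obtain q where q: "p = [:- c, 1:] * q" using poly_eq_0_iff_dvd by (auto simp: dvd_def)
  then have "q \<noteq> 0" using Suc.prems(2) by auto
  then have "degree p = Suc (degree q)" unfolding q by (subst degree_mult_eq) auto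
  then have deg: "n = degree q" using Suc.hyps(2) by simp
  have memS: "T w - c *s w \<in> S"
    using Suc.prems(1) S by (intro subspace_diff[OF S(1)] subspace_scale[OF S(1)]) auto
  have "T w - c *s w \<in> span (S \<inter> (\<Union>c. gen_eig T c))"
    using Suc.hyps(1)[OF deg memS \<open>q \<noteq> 0\<close>] Suc.prems(3) poly_op_linear_factor[OF T] q by simp
  then obtain F f where F: "finite F" "F \<subseteq> S \<inter> (\<Union>c. gen_eig T c)"
    and eq: "T w - c *s w = (\<Sum>a\<in>F. f a *s a)"
    by (auto simp: span_explicit)
  define P where "P = (\<lambda>a u. u \<in> S \<inter> (\<Union>c. gen_eig T c) \<and> T u - c *s u = a)"
  have ex: "\<exists>u. P a u" if "a \<in> F" "a \<notin> gen_eig T c" for a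
  proof -
    obtain \<mu> where "a \<in> gen_eig T \<mu>" using F(2) \<open>a \<in> F\<close> by blast
    then show ?thesis
      using gen_eig_shift_surj[OF T S, of a \<mu> c] F(2) that unfolding P_def by blast
  qed
  \<comment> \<open>The components for \<open>c\<close> itself get the value \<open>0\<close>; they
    are what survives in \<open>T (w - y) - c *s (w - y)\<close>.\<close>
  define u where "u a = (if a \<in> gen_eig T c then 0 else SOME u. P a u)" for a
  have u: "P a (u a)" if "a \<in> F" "a \<notin> gen_eig T c" for a
    using someI_ex[OF ex[OF that]] that by (simp add: u_def)
  have u0: "u a = 0" if "a \<in> gen_eig T c" for a using that by (simp add: u_def)
  define y where "y = (\<Sum>a\<in>F. f a *s u a)"
  have uS: "u a \<in> span (S \<inter> (\<Union>c. gen_eig T c))" if "a \<in> F" for a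
    using u[OF that] u0[of a] by (cases "a \<in> gen_eig T c") (auto simp: P_def span_zero intro: span_base)
  have y: "y \<in> span (S \<inter> (\<Union>c. gen_eig T c))"
    unfolding y_def by (intro span_sum span_scale uS)
  have "T (w - y) - c *s (w - y) = (T w - c *s w) - (T y - c *s y)"
    by (simp add: linearD[OF T] algebra_simps)
  also have "T y - c *s y = (\<Sum>a\<in>F. f a *s (T (u a) - c *s u a))"
    unfolding y_def by (simp add: linearD[OF T] scale_sum_right scale_right_diff_distrib
        sum_subtractf mult.commute)
  also have "(T w - c *s w) - \<dots> = (\<Sum>a\<in>F. f a *s (a - (T (u a) - c *s u a)))"
    unfolding eq by (simp add: scale_right_diff_distrib sum_subtractf)
  also have "\<dots> \<in> gen_eig T c"
  proof (intro subspace_sum[OF subspace_gen_eig[OF T]] subspace_scale[OF subspace_gen_eig[OF T]])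
    fix a assume "a \<in> F"
    show "a - (T (u a) - c *s u a) \<in> gen_eig T c"
    proof (cases "a \<in> gen_eig T c")
      case True
      then show ?thesis using u0 linear_zero[OF T] by simp
    next
      case False
      then show ?thesis using u[OF \<open>a \<in> F\<close>] subspace_0[OF subspace_gen_eig[OF T]] by (simp add: P_def)
    qed
  qed
  finally obtain k where "((\<lambda>y. T y - c *s y) ^^ k) (T (w - y) - c *s (w - y)) = 0"
    by (auto simp: gen_eig_def)
  then have "((\<lambda>y. T y - c *s y) ^^ Suc k) (w - y) = 0" by (simp only: funpow_Suc_right comp_apply)
  then have wy: "w - y \<in> gen_eig T c" by (rule gen_eigI)
  have "span (S \<inter> (\<Union>c. gen_eig T c)) \<subseteq> S" using S(1) by (intro span_minimal) auto
  then have "w - y \<in> S" using y Suc.prems(1) subspace_diff[OF S(1)] by blast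
  with wy have "w - y \<in> span (S \<inter> (\<Union>c. gen_eig T c))" by (intro span_base) auto
  from span_add[OF this y] show ?case by simp
qed

text \<open>Iterates of \<open>w\<close> stay in \<open>S\<close> and become dependent, which yields
  an annihilating polynomial. Finiteness is required of \<open>S\<close> alone, so that the
  decomposition applies to a Lie algebra inside the space of all additive endomorphisms.\<close>

lemma span_gen_eig:
  assumes T: "Vector_Spaces.linear scale scale T" and S: "subspace S" "\<And>y. y \<in> S \<Longrightarrow> T y \<in> S"
    and w: "w \<in> S" and F: "finite F" "S \<subseteq> span F"
  shows "w \<in> span (S \<inter> (\<Union>c. gen_eig T c))"
proof -
  have "\<exists>k. (T ^^ k) w \<in> span ((\<lambda>i. (T ^^ i) w) ` {..<k})"
  proof (rule ccontr)
    assume "\<not> ?thesis"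
    then have "Suc (card F) \<le> card F"
      using F funpow_mem[of w S T, OF w S(2)] by (intro no_long_chain[of F _ "\<lambda>i. (T ^^ i) w"]) auto
    then show False by simp
  qed
  then obtain k where "(T ^^ k) w \<in> span ((\<lambda>i. (T ^^ i) w) ` {..<k})" by blast
  from span_image_lessThan[OF this]
  obtain c where c: "(T ^^ k) w = (\<Sum>i<k. c i *s (T ^^ i) w)" by blast
  define p where "p = monom 1 k - (\<Sum>i<k. monom (c i) i)"
  have coeff: "coeff p i = (if i = k then 1 else if i < k then - c i else 0)" for i
    by (auto simp: p_def coeff_sum coeff_monom)
  then have "p \<noteq> 0" by (metis coeff_0 zero_neq_one)
  have "degree p \<le> k" by (intro degree_le) (simp add: coeff)
  then have "poly_op p T w = (\<Sum>i\<le>k. coeff p i *s (T ^^ i) w)" by (rule poly_op_altdef)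
  also have "\<dots> = 0"
    using c by (simp add: lessThan_Suc_atMost[symmetric] coeff sum_negf)
  finally show ?thesis using span_gen_eig_if_poly_op[OF T S w \<open>p \<noteq> 0\<close>] by blast
qed

end

section \<open>The ring of additive endomorphisms\<close>

text \<open>The ring structure lets commutators and formal power series with operator coefficients be handled
  by type classes. It is not of class \<open>ring_1\<close>, since \<open>0 = 1\<close> on the trivial group.\<close>

typedef (overloaded) 'a endo = "{f :: 'a::ab_group_add \<Rightarrow> 'a. \<forall>x y. f (x + y) = f x + f y}"
  morphisms app Endo
  by (rule exI[of _ "\<lambda>_. 0"]) auto

notation app (infixr "\<cdot>" 75)

setup_lifting type_definition_endo

lemma endo_eqI: "(\<And>x. D \<cdot> x = E \<cdot> x) \<Longrightarrow> D = E"
  by transfer auto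

lemma app_add_right [simp]: "D \<cdot> (x + y) = D \<cdot> x + D \<cdot> y"
  by transfer auto

lemma app_zero_right [simp]: "D \<cdot> 0 = 0"
  using app_add_right[of D 0 0] by simp

lemma app_minus_right [simp]: "D \<cdot> (- x) = - (D \<cdot> x)"
  using app_add_right[of D x "- x"] by (simp add: eq_neg_iff_add_eq_0 add.commute)

lemma app_diff_right [simp]: "D \<cdot> (x - y) = D \<cdot> x - D \<cdot> y"
  using app_add_right[of D x "- y"] by simp

lemma app_sum_right: "D \<cdot> sum f I = (\<Sum>i\<in>I. D \<cdot> f i)"
  by (induction I rule: infinite_finite_induct) auto

instantiation endo :: (ab_group_add) "{ring, monoid_mult}"
begin

lift_definition zero_endo :: "'a endo" is "\<lambda>_. 0" by simp
lift_definition one_endo :: "'a endo" is "\<lambda>x. x" by simp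
lift_definition plus_endo :: "'a endo \<Rightarrow> 'a endo \<Rightarrow> 'a endo" is "\<lambda>f g x. f x + g x"
  by (simp add: algebra_simps)
lift_definition minus_endo :: "'a endo \<Rightarrow> 'a endo \<Rightarrow> 'a endo" is "\<lambda>f g x. f x - g x"
  by (simp add: algebra_simps)
lift_definition uminus_endo :: "'a endo \<Rightarrow> 'a endo" is "\<lambda>f x. - f x"
  by (simp add: algebra_simps)
lift_definition times_endo :: "'a endo \<Rightarrow> 'a endo \<Rightarrow> 'a endo" is "\<lambda>f g x. f (g x)"
  by simp

instance
  by standard (transfer; simp add: fun_eq_iff algebra_simps)+

end

lemma app_simps [simp]:
  "0 \<cdot> x = 0" "1 \<cdot> x = x" "(D + E) \<cdot> x = D \<cdot> x + E \<cdot> x" "(D - E) \<cdot> x = D \<cdot> x - E \<cdot> x"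
  "(- D) \<cdot> x = - (D \<cdot> x)" "(D * E) \<cdot> x = D \<cdot> E \<cdot> x"
  by (transfer; simp)+

lemma app_sum: "sum f I \<cdot> x = (\<Sum>i\<in>I. f i \<cdot> x)"
  by (induction I rule: infinite_finite_induct) auto

lemma app_power: "(D ^ k) \<cdot> x = (app D ^^ k) x"
  by (induction k) auto

lemma funpow_additive:
  fixes S :: "'x::plus \<Rightarrow> 'x"
  assumes "\<And>u v. S (u + v) = S u + S v"
  shows "(S ^^ k) (x + y) = (S ^^ k) x + (S ^^ k) y"
proof (induction k)
  case 0
  show ?case by simp
next
  case (Suc k)
  then show ?case using assms by simp
qed

text \<open>Expanding the power by the Leibniz rule gives terms with \<open>S1\<close> applied
  \<open>i\<close> times and \<open>S2\<close> applied \<open>j\<close> times,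
  \<open>i + j = k + l\<close>, so \<open>i \<ge> k\<close> or \<open>j \<ge> l\<close>. The action
  of operators on vectors and the product of operators are both instances of
  \<open>b\<close>.\<close>

lemma funpow_leibniz_zero:
  fixes b :: "'x::zero \<Rightarrow> 'y::zero \<Rightarrow> 'z::ab_group_add"
  assumes zero: "\<And>y. b 0 y = 0" "\<And>x. b x 0 = 0"
    and add: "\<And>u v. S3 (u + v) = S3 u + S3 v"
    and deriv: "\<And>x y. x \<in> P \<Longrightarrow> S3 (b x y) = b (S1 x) y + b x (S2 y)"
    and P: "\<And>x. x \<in> P \<Longrightarrow> S1 x \<in> P"
    and "x \<in> P" "(S1 ^^ k) x = 0" "(S2 ^^ l) y = 0"
  shows "(S3 ^^ (k + l)) (b x y) = 0"
proof -
  have S3_0: "(S3 ^^ n) 0 = 0" for n using funpow_additive[of S3 n 0 0] add by simp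
  show ?thesis using assms(6-8)
  proof (induction n \<equiv> "k + l" arbitrary: k l x y)
    case 0
    then show ?case by (simp add: zero)
  next
    case (Suc n)
    show ?case
    proof (cases "k = 0 \<or> l = 0")
      case True
      then have "b x y = 0" using Suc.prems zero by auto
      then show ?thesis using S3_0 by simp
    next
      case False
      then obtain k' l' where kl: "k = Suc k'" "l = Suc l'" by (metis not0_implies_Suc)
      have "(S3 ^^ n) (b (S1 x) y) = 0"
        using Suc.hyps(1)[of k' l "S1 x" y] Suc.hyps(2) Suc.prems P kl by (simp add: funpow_swap1)
      moreover have "(S3 ^^ n) (b x (S2 y)) = 0"
        using Suc.hyps(1)[of k l' x "S2 y"] Suc.hyps(2) Suc.prems kl by (simp add: funpow_swap1)
      ultimately have "(S3 ^^ n) (S3 (b x y)) = 0"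
        using deriv[OF Suc.prems(1)] funpow_additive[OF add] by simp
      then show ?thesis by (simp only: Suc.hyps(2)[symmetric] funpow_Suc_right comp_apply)
    qed
  qed
qed

section \<open>Nilpotency, independence and pencils in finite dimension\<close>

locale fin_dim_complex_space = finite_dimensional_vector_space scale Basis
  for scale :: "complex \<Rightarrow> 'a::ab_group_add \<Rightarrow> 'a" (infixr "*s" 75) and Basis
begin

sublocale complex_vector_space scale ..

lemma Basis_span: "x \<in> span Basis"
  using span_Basis by simp

lemma funpow_dimension_zero:
  assumes T: "Vector_Spaces.linear scale scale T" and "(T ^^ k) x = 0"
  shows "(T ^^ dimension) x = 0"
proof -
  define n where "n = (LEAST k. (T ^^ k) x = 0)"
  have n: "(T ^^ n) x = 0" unfolding n_def by (rule LeastI[of "\<lambda>k. (T ^^ k) x = 0", OF assms(2)])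
  have "n \<le> card Basis"
  \<comment> \<open>The iterates are listed from the last nonzero one backwards:
    \<open>T ^^ j\<close> then kills the first \<open>j\<close> of them but not the next.\<close>
  proof (rule no_long_chain[OF finite_Basis])
    fix j assume "j < n"
    show "(T ^^ (n - Suc j)) x \<notin> span ((\<lambda>j. (T ^^ (n - Suc j)) x) ` {..<j})"
    proof
      assume "(T ^^ (n - Suc j)) x \<in> span ((\<lambda>j. (T ^^ (n - Suc j)) x) ` {..<j})"
      then obtain c where c: "(T ^^ (n - Suc j)) x = (\<Sum>i<j. c i *s (T ^^ (n - Suc i)) x)"
        using span_image_lessThan by blast
      have "(T ^^ j) ((T ^^ (n - Suc j)) x) = (\<Sum>i<j. c i *s (T ^^ (j + (n - Suc i))) x)"
        unfolding c linearD[OF linear_funpow[OF T]] by (simp add: funpow_add)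
      also have "\<dots> = 0"
      proof (rule sum.neutral, intro ballI)
        fix i assume "i \<in> {..<j}"
        then have "(T ^^ (j + (n - Suc i))) x = 0"
          using \<open>j < n\<close> by (intro funpow_zero_mono[OF T n]) auto
        then show "c i *s (T ^^ (j + (n - Suc i))) x = 0" by simp
      qed
      finally have "(T ^^ (j + (n - Suc j))) x = 0" by (simp add: funpow_add)
      moreover have "j + (n - Suc j) < n" using \<open>j < n\<close> by simp
      ultimately show False using not_less_Least[of _ "\<lambda>k. (T ^^ k) x = 0"] by (simp add: n_def)
    qed
  qed (rule Basis_span)
  then show ?thesis using funpow_zero_mono[OF T n] by (simp add: dimension_def)
qed

text \<open>\<open>T ^^ k\<close> kills \<open>y i\<close> for \<open>i < k\<close> but not
  \<open>y k\<close>, so the \<open>y k\<close> are independent. This gives the contradiction both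
  for injectivity off the null component and at the end of the proof.\<close>

lemma no_infinite_preimage_chain:
  assumes T: "Vector_Spaces.linear scale scale T"
    and "y 0 \<noteq> 0" "T (y 0) = 0" "\<And>k. T (y (Suc k)) = c k *s y k" "\<And>k. c k \<noteq> 0"
  shows False
proof -
  have kill: "(T ^^ k) (y i) = 0" if "i < k" for i k
    using that
  proof (induction k arbitrary: i)
    case (Suc k)
    show ?case
    proof (cases i)
      case 0
      then show ?thesis using assms(3) linear_zero[OF linear_funpow[OF T]]
        by (simp add: funpow_swap1[of T])
    next
      case (Suc j)
      then show ?thesis using Suc.IH[of j] Suc.prems assms(4) linearD[OF linear_funpow[OF T]]
        by (simp add: funpow_swap1[of T])
    qed
  qed simp
  have nz: "(T ^^ k) (y k) \<noteq> 0" for k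
  proof (induction k)
    case (Suc k)
    then show ?case using assms(4,5) linearD[OF linear_funpow[OF T]] by (simp add: funpow_swap1[of T])
  qed (use assms(2) in simp)
  have "Suc (card Basis) \<le> card Basis"
  proof (rule no_long_chain[OF finite_Basis])
    fix k
    show "y k \<notin> span (y ` {..<k})"
    proof
      assume "y k \<in> span (y ` {..<k})"
      then obtain a where "y k = (\<Sum>i<k. a i *s y i)" using span_image_lessThan by blast
      then have "(T ^^ k) (y k) = (\<Sum>i<k. a i *s (T ^^ k) (y i))"
        by (simp only: linearD[OF linear_funpow[OF T]])
      then show False using nz kill by simp
    qed
  qed (rule Basis_span)
  then show False by simp
qed

text \<open>The classical independence of eigenvectors for distinct eigenvalues, with
  \<open>f\<close> in place of the identity; injectivity of \<open>f\<close> on \<open>U\<close>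
  allows \<open>f\<close> to be cancelled. Taking the identity for \<open>f\<close> gives finiteness
  of the spectrum.\<close>

lemma finite_pencil_eigenvalues:
  assumes f: "Vector_Spaces.linear scale scale f" and g: "Vector_Spaces.linear scale scale g"
    and U: "subspace U" and inj: "\<And>x. x \<in> U \<Longrightarrow> f x = 0 \<Longrightarrow> x = 0"
  shows "finite {c. \<exists>x\<in>U. x \<noteq> 0 \<and> g x = c *s f x}"
proof (rule ccontr)
  assume "infinite {c. \<exists>x\<in>U. x \<noteq> 0 \<and> g x = c *s f x}"
  then obtain \<tau> :: "nat \<Rightarrow> complex"
    where \<tau>: "inj \<tau>" "range \<tau> \<subseteq> {c. \<exists>x\<in>U. x \<noteq> 0 \<and> g x = c *s f x}"
    using infinite_countable_subset by blast
  then have "\<forall>k. \<exists>x. x \<in> U \<and> x \<noteq> 0 \<and> g x = \<tau> k *s f x" by blast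
  then obtain v where v: "\<And>k. v k \<in> U" "\<And>k. v k \<noteq> 0" "\<And>k. g (v k) = \<tau> k *s f (v k)"
    by metis
  have indep: "\<forall>i<k. c i = 0" if "(\<Sum>i<k. c i *s v i) = 0" for c and k :: nat
    using that
  proof (induction k arbitrary: c)
    case (Suc k)
    have "f (\<Sum>i<Suc k. (c i * \<tau> i) *s v i) = g (\<Sum>i<Suc k. c i *s v i)"
      unfolding linearD[OF f] linearD[OF g] by (simp only: v(3) scale_scale)
    also have "\<dots> = 0" unfolding Suc.prems by (rule linear_zero[OF g])
    finally have "(\<Sum>i<Suc k. (c i * \<tau> i) *s v i) = 0"
      by (rule inj[rotated]) (intro subspace_sum[OF U] subspace_scale[OF U] v)
    then have "(\<Sum>i<Suc k. (c i * \<tau> i) *s v i) - \<tau> k *s (\<Sum>i<Suc k. c i *s v i) = 0"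
      using Suc.prems by simp
    also have "(\<Sum>i<Suc k. (c i * \<tau> i) *s v i) - \<tau> k *s (\<Sum>i<Suc k. c i *s v i)
        = (\<Sum>i<k. (c i * (\<tau> i - \<tau> k)) *s v i)"
      unfolding scale_sum_right sum_subtractf[symmetric]
      by (simp add: algebra_simps flip: scale_left_diff_distrib)
    finally have "\<forall>i<k. c i * (\<tau> i - \<tau> k) = 0" by (rule Suc.IH)
    then have "\<forall>i<k. c i = 0" using \<tau>(1) by (auto simp: inj_eq)
    moreover from this have "c k = 0" using Suc.prems v(2) by simp
    ultimately show ?case by (auto simp: less_Suc_eq)
  qed simp
  have "Suc (card Basis) \<le> card Basis"
  proof (rule no_long_chain[OF finite_Basis])
    fix k
    show "v k \<notin> span (v ` {..<k})"
    proof
      assume "v k \<in> span (v ` {..<k})"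
      then obtain a where "v k = (\<Sum>i<k. a i *s v i)" using span_image_lessThan by blast
      then have "(\<Sum>i<Suc k. (if i < k then a i else - 1) *s v i) = 0" by simp
      from indep[OF this] show False by force
    qed
  qed (rule Basis_span)
  then show False by simp
qed

section \<open>Complex-linear endomorphisms and their vector space structure\<close>

definition scal :: "complex \<Rightarrow> 'a endo" where
  "scal c = Endo (\<lambda>x. c *s x)"

lemma app_scal [simp]: "scal c \<cdot> x = c *s x"
  unfolding scal_def by (subst Endo_inverse) (auto simp: scale_right_distrib)

definition escale :: "complex \<Rightarrow> 'a endo \<Rightarrow> 'a endo" where
  "escale c D = scal c * D"

lemma app_escale [simp]: "escale c D \<cdot> x = c *s D \<cdot> x"
  by (simp add: escale_def)

sublocale E: complex_vector_space escale
  by unfold_locales (auto intro!: endo_eqI simp: scale_right_distrib scale_left_distrib)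

text \<open>The scalar action is a locale parameter and so invisible to the type of additive
  endomorphisms; the linear maps are therefore singled out as a subspace.\<close>

definition lin :: "'a endo set" where
  "lin = {D. \<forall>c x. D \<cdot> (c *s x) = c *s D \<cdot> x}"

lemma lin_scale: "D \<in> lin \<Longrightarrow> D \<cdot> (c *s x) = c *s D \<cdot> x"
  by (simp add: lin_def)

lemma lin_iff_linear: "D \<in> lin \<longleftrightarrow> Vector_Spaces.linear scale scale (app D)"
  by (simp add: lin_def Vector_Spaces.linear_iff vector_space_axioms)

lemma lin_linear: "D \<in> lin \<Longrightarrow> Vector_Spaces.linear scale scale (app D)"
  by (simp add: lin_iff_linear)

lemma subspace_lin: "E.subspace lin"
  by (rule E.subspaceI) (auto simp: lin_def scale_right_distrib mult.commute)

lemma lin_mult: "D \<in> lin \<Longrightarrow> E \<in> lin \<Longrightarrow> D * E \<in> lin"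
  by (simp add: lin_def)

lemma escale_mult: "escale c D * E = escale c (D * E)"
  by (simp add: escale_def mult.assoc)

lemma mult_escale: "D \<in> lin \<Longrightarrow> D * escale c E = escale c (D * E)"
  by (auto intro!: endo_eqI simp: lin_scale)

lemma lin_subset_span:
  obtains F where "finite F" "lin \<subseteq> E.span F"
proof
  \<comment> \<open>\<open>M b c\<close> is the matrix unit sending the basis vector
    \<open>b\<close> to \<open>c\<close>.\<close>
  define M where "M b c = Endo (\<lambda>x. representation Basis x b *s c)" for b c
  have app_M: "M b c \<cdot> x = representation Basis x b *s c" for b c x
    unfolding M_def
    by (subst Endo_inverse)
      (auto simp: representation_add independent_Basis span_Basis scale_left_distrib)
  have expand: "x = (\<Sum>b\<in>Basis. representation Basis x b *s b)" for x
    using sum_representation_eq[OF independent_Basis Basis_span finite_Basis order_refl] by simp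
  show "finite ((\<lambda>(b, c). M b c) ` (Basis \<times> Basis))" using finite_Basis by simp
  show "lin \<subseteq> E.span ((\<lambda>(b, c). M b c) ` (Basis \<times> Basis))"
  proof
    fix D assume D: "D \<in> lin"
    have "D = (\<Sum>b\<in>Basis. \<Sum>c\<in>Basis. escale (representation Basis (D \<cdot> b) c) (M b c))"
    proof (rule endo_eqI)
      fix x
      have "D \<cdot> x = D \<cdot> (\<Sum>b\<in>Basis. representation Basis x b *s b)" using expand by simp
      also have "\<dots> = (\<Sum>b\<in>Basis. representation Basis x b *s D \<cdot> b)"
        by (simp add: app_sum_right lin_scale[OF D])
      also have "\<dots> = (\<Sum>b\<in>Basis. representation Basis x b *s
          (\<Sum>c\<in>Basis. representation Basis (D \<cdot> b) c *s c))"
        using expand by simp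
      also have "\<dots> = (\<Sum>b\<in>Basis. \<Sum>c\<in>Basis. escale (representation Basis (D \<cdot> b) c) (M b c)) \<cdot> x"
        by (simp add: app_sum app_M scale_sum_right mult.commute)
      finally show "D \<cdot> x = \<dots>" .
    qed
    also have "\<dots> \<in> E.span ((\<lambda>(b, c). M b c) ` (Basis \<times> Basis))"
      by (intro E.span_sum E.span_scale E.span_base) auto
    finally show "D \<in> E.span ((\<lambda>(b, c). M b c) ` (Basis \<times> Basis))" .
  qed
qed

section \<open>Commutators and generalised weights\<close>

definition commutator :: "'a endo \<Rightarrow> 'a endo \<Rightarrow> 'a endo" where
  "commutator D E = D * E - E * D"

lemma app_commutator: "commutator D E \<cdot> x = D \<cdot> E \<cdot> x - E \<cdot> D \<cdot> x"
  by (simp add: commutator_def)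

lemma linear_commutator: "D \<in> lin \<Longrightarrow> Vector_Spaces.linear escale escale (commutator D)"
  by (auto simp: Vector_Spaces.linear_iff E.vector_space_axioms commutator_def algebra_simps
      escale_mult mult_escale E.scale_right_diff_distrib)

lemma lin_commutator: "D \<in> lin \<Longrightarrow> E \<in> lin \<Longrightarrow> commutator D E \<in> lin"
  unfolding commutator_def by (intro E.subspace_diff[OF subspace_lin] lin_mult)

text \<open>Weights add: \<open>h - (a + c)\<close> applied to \<open>D \<cdot> x\<close> splits by
  the Leibniz rule into \<open>commutator h D - a D\<close> applied to \<open>x\<close> and
  \<open>D\<close> applied to \<open>(h - c) x\<close>.\<close>

lemma gen_eig_app:
  assumes h: "h \<in> lin" and D: "D \<in> lin" "D \<in> E.gen_eig (commutator h) a" and x: "x \<in> gen_eig (app h) c"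
  shows "D \<cdot> x \<in> gen_eig (app h) (a + c)"
proof -
  obtain k l where k: "((\<lambda>E. commutator h E - escale a E) ^^ k) D = 0"
    and l: "((\<lambda>y. h \<cdot> y - c *s y) ^^ l) x = 0"
    using D(2) x by (auto simp: gen_eig_def E.gen_eig_def)
  have "((\<lambda>y. h \<cdot> y - (a + c) *s y) ^^ (k + l)) (D \<cdot> x) = 0"
  proof (rule funpow_leibniz_zero[where P = lin, OF _ _ _ _ _ D(1) k l])
    show "commutator h E - escale a E \<in> lin" if "E \<in> lin" for E
      using that lin_commutator[OF h that]
      by (intro E.subspace_diff[OF subspace_lin] E.subspace_scale[OF subspace_lin]) auto
  qed (auto simp: app_commutator lin_scale algebra_simps)
  then show ?thesis by (rule gen_eigI)
qed

text \<open>\<open>commutator h\<close> is a derivation of the associative product. Closure under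
  products makes the null component closed under commutators, as Engel's theorem requires.\<close>

lemma gen_eig_commutator_0_mult:
  assumes "D \<in> E.gen_eig (commutator h) 0" "E \<in> E.gen_eig (commutator h) 0"
  shows "D * E \<in> E.gen_eig (commutator h) 0"
proof -
  obtain k l where k: "(commutator h ^^ k) D = 0" and l: "(commutator h ^^ l) E = 0"
    using assms by (auto simp: E.gen_eig_0_iff)
  have "(commutator h ^^ (k + l)) (D * E) = 0"
    by (rule funpow_leibniz_zero[where P = UNIV, OF _ _ _ _ _ _ k l])
      (auto simp: commutator_def algebra_simps)
  then show ?thesis by (auto simp: E.gen_eig_0_iff)
qed

end

section \<open>Engel's theorem and regular elements\<close>

text \<open>When \<open>K\<close> preserves \<open>U\<close>, level \<open>i\<close> collects the
  vectors of \<open>U\<close> killed by all products of \<open>i\<close> operators from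
  \<open>K\<close>. That some level contains \<open>U\<close> means that \<open>K\<close> acts on
  \<open>U\<close> by simultaneously strictly triangular maps.\<close>

primrec flag :: "'a::ab_group_add set \<Rightarrow> 'a endo set \<Rightarrow> nat \<Rightarrow> 'a set" where
  "flag U K 0 = {0}"
| "flag U K (Suc i) = {x \<in> U. \<forall>D\<in>K. D \<cdot> x \<in> flag U K i}"

context fin_dim_complex_space
begin

lemma commutator_in_subspace_lincomb:
  assumes K: "E.subspace K" and "commutator D D' \<in> K" "commutator D X \<in> K" "commutator D' X \<in> K"
    and lin: "D \<in> lin" "D' \<in> lin" "X \<in> lin"
  shows "commutator (D + escale a X) (D' + escale b X) \<in> K"
proof -
  have "commutator (D + escale a X) (D' + escale b X)
      = commutator D D' + escale b (commutator D X) - escale a (commutator D' X)"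
    by (rule endo_eqI) (simp add: app_commutator lin lin_scale algebra_simps)
  then show ?thesis using assms by (auto intro!: E.subspace_add E.subspace_diff E.subspace_scale)
qed

text \<open>The ascending flag of joint kernels replaces the quotient \<open>S / K\<close> of the textbook proof: an
  element of \<open>S - K\<close> shifting the flag as far down as possible normalises \<open>K\<close>.\<close>

lemma engel:
  assumes U: "subspace U" "\<exists>x\<in>U. x \<noteq> 0"
    and S: "E.subspace S" "S \<subseteq> lin" "\<And>D E. D \<in> S \<Longrightarrow> E \<in> S \<Longrightarrow> commutator D E \<in> S"
    and inv: "\<And>D x. D \<in> S \<Longrightarrow> x \<in> U \<Longrightarrow> D \<cdot> x \<in> U"
    and nil: "\<And>D x. D \<in> S \<Longrightarrow> x \<in> U \<Longrightarrow> \<exists>k. (app D ^^ k) x = 0"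
  shows "\<exists>x\<in>U. x \<noteq> 0 \<and> (\<forall>D\<in>S. D \<cdot> x = 0)"
proof -
  \<comment> \<open>Operators vanishing on \<open>U\<close> are put into every \<open>good\<close>
    subalgebra, so that an \<open>X\<close> outside such a subalgebra acts nontrivially on
    \<open>U\<close>.\<close>
  define K0 where "K0 = {D \<in> S. \<forall>x\<in>U. D \<cdot> x = 0}"
  define good where "good K \<longleftrightarrow> K0 \<subseteq> K \<and> K \<subseteq> S \<and> E.subspace K \<and>
    (\<forall>D\<in>K. \<forall>E\<in>K. commutator D E \<in> K) \<and> (\<exists>m. U \<subseteq> flag U K m)" for K
  have flag_sub: "subspace (flag U K i)" if "K \<subseteq> S" for K i
  proof (induction i)
    case (Suc i)
    show ?case
      using that S(2) U(1) Suc
      by (intro subspaceI) (auto simp: subspace_0 subspace_add subspace_scale lin_scale subset_iff)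
  qed simp
  have flag_U: "flag U K i \<subseteq> U" for K i using U(1) by (cases i) (auto simp: subspace_0)
  have flag_Suc: "flag U K i \<subseteq> flag U K (Suc i)" for K i
  proof (induction i)
    case 0
    show ?case using U(1) by (auto simp: subspace_0)
  next
    case (Suc i)
    then show ?case by auto
  qed
  have flag_mono: "flag U K i \<subseteq> flag U K j" if "i \<le> j" for K i j
    using flag_Suc by (rule lift_Suc_mono_le[OF _ that])
  have good_extend: "\<exists>K'. good K' \<and> K \<subset> K'" if K: "good K" and "K \<noteq> S" for K
  proof -
    define V where "V = flag U K"
    have V0: "V 0 = {0}" by (simp add: V_def)
    have VSuc: "x \<in> V (Suc i) \<longleftrightarrow> x \<in> U \<and> (\<forall>D\<in>K. D \<cdot> x \<in> V i)" for x i by (simp add: V_def)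
    have VU: "V i \<subseteq> U" for i unfolding V_def by (rule flag_U)
    have Vmono: "V i \<subseteq> V j" if "i \<le> j" for i j unfolding V_def by (rule flag_mono[OF that])
    have KS: "K \<subseteq> S" and Ksub: "E.subspace K" and KK0: "K0 \<subseteq> K"
      and Kbr: "\<And>D E. D \<in> K \<Longrightarrow> E \<in> K \<Longrightarrow> commutator D E \<in> K"
      using K by (auto simp: good_def)
    have Vsub: "subspace (V i)" for i unfolding V_def by (rule flag_sub[OF KS])
    obtain m where m: "U \<subseteq> V m" using K by (auto simp: good_def V_def)
    \<comment> \<open>An operator in \<open>G s\<close> moves the flag by \<open>s - m\<close>
      levels; the offset \<open>m\<close> encodes downward shifts by natural numbers. At
      \<open>2 * m\<close> every element of \<open>S\<close> qualifies, at \<open>0\<close> only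
      operators vanishing on \<open>U\<close>.\<close>
    define G where "G s = {X. \<forall>i. \<forall>x\<in>V i. X \<cdot> x \<in> V (i + s - m)}" for s
    define P where "P s \<longleftrightarrow> (\<exists>X\<in>S - K. X \<in> G s)" for s
    have "P (2 * m)"
    proof -
      obtain X where "X \<in> S - K" using KS \<open>K \<noteq> S\<close> by blast
      moreover have "X \<in> G (2 * m)" unfolding G_def
      proof (intro CollectI allI ballI)
        fix i x assume "x \<in> V i"
        then have "X \<cdot> x \<in> V m" using VU m inv \<open>X \<in> S - K\<close> by blast
        then show "X \<cdot> x \<in> V (i + 2 * m - m)" using Vmono[of m "i + 2 * m - m"] by auto
      qed
      ultimately show ?thesis unfolding P_def by blast
    qed
    define s where "s = (LEAST s. P s)"
    have "P s" unfolding s_def using \<open>P (2 * m)\<close> by (rule LeastI)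
    then obtain X where X: "X \<in> S" "X \<notin> K" "X \<in> G s" unfolding P_def by blast
    have "s \<noteq> 0"
    proof
      assume "s = 0"
      have "X \<cdot> x = 0" if "x \<in> U" for x
      proof -
        have "X \<cdot> x \<in> V (m + s - m)" using X(3) m that unfolding G_def by blast
        then show ?thesis using \<open>s = 0\<close> V0 by simp
      qed
      then have "X \<in> K0" using X(1) by (auto simp: K0_def)
      then show False using X(2) KK0 by blast
    qed
    then obtain r where r: "s = Suc r" by (cases s) auto
    \<comment> \<open>A commutator with an element of \<open>K\<close>, which lowers the flag,
      improves the shift by one; minimality of \<open>s\<close> then forces it into
      \<open>K\<close>.\<close>
    have XK: "commutator D X \<in> K" if "D \<in> K" for D
    proof -
      have "commutator D X \<in> G r" unfolding G_def
      proof (intro CollectI allI ballI)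
        fix i x assume x: "x \<in> V i"
        have "D \<cdot> X \<cdot> x \<in> V (i + r - m)"
        proof (cases "i + s - m")
          case 0
          then have "X \<cdot> x = 0" using X(3) x V0 unfolding G_def by fastforce
          then show ?thesis using subspace_0[OF Vsub] by simp
        next
          case (Suc j)
          then have "X \<cdot> x \<in> V (Suc j)" using X(3) x unfolding G_def by fastforce
          moreover have "j = i + r - m" using Suc r by simp
          ultimately show ?thesis using that VSuc by simp
        qed
        moreover have "X \<cdot> D \<cdot> x \<in> V (i + r - m)"
        proof (cases i)
          case 0
          then show ?thesis using x V0 subspace_0[OF Vsub] by simp
        next
          case (Suc j)
          then have "D \<cdot> x \<in> V j" using x that VSuc by simp
          then have "X \<cdot> D \<cdot> x \<in> V (j + s - m)" using X(3) unfolding G_def by blast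
          then show ?thesis using Suc r by simp
        qed
        ultimately show "commutator D X \<cdot> x \<in> V (i + r - m)"
          unfolding app_commutator by (rule subspace_diff[OF Vsub])
      qed
      moreover have "commutator D X \<in> S" using that X(1) KS S(3) by blast
      ultimately show ?thesis using not_less_Least[of r P] r unfolding s_def P_def by auto
    qed
    define K' where "K' = {D + escale c X | D c. D \<in> K}"
    have K'I: "D + escale c X \<in> K'" if "D \<in> K" for D c using that unfolding K'_def by blast
    have KK': "K \<subseteq> K'" using K'I[of _ 0] by auto
    have "X \<in> K'" using K'I[OF E.subspace_0[OF Ksub], of 1] by simp
    have K'S: "K' \<subseteq> S" unfolding K'_def
      using KS X(1) S(1) by (auto intro!: E.subspace_add E.subspace_scale)
    have K'sub: "E.subspace K'"
    proof (rule E.subspaceI)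
      show "0 \<in> K'" using KK' E.subspace_0[OF Ksub] by blast
    next
      fix D D' assume "D \<in> K'" "D' \<in> K'"
      then obtain E c E' c' where D: "D = E + escale c X" "D' = E' + escale c' X"
        and E: "E \<in> K" "E' \<in> K"
        unfolding K'_def by blast
      have "D + D' = (E + E') + escale (c + c') X"
        unfolding D by (simp add: E.scale_left_distrib add_ac)
      also have "\<dots> \<in> K'" by (rule K'I[OF E.subspace_add[OF Ksub E]])
      finally show "D + D' \<in> K'" .
    next
      fix a D assume "D \<in> K'"
      then obtain E c where "D = E + escale c X" "E \<in> K" unfolding K'_def by blast
      then show "escale a D \<in> K'"
        using K'I[of "escale a E" "a * c"] E.subspace_scale[OF Ksub]
        by (simp add: E.scale_right_distrib)
    qed
    have K'br: "commutator D D' \<in> K'" if D: "D \<in> K'" "D' \<in> K'" for D D'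
    proof -
      obtain E c E' c' where "D = E + escale c X" "D' = E' + escale c' X" "E \<in> K" "E' \<in> K"
        using D unfolding K'_def by blast
      then have "commutator D D' \<in> K"
        using Kbr XK KS S(2) X(1) commutator_in_subspace_lincomb[OF Ksub] by (auto simp: subset_iff)
      then show ?thesis using KK' by blast
    qed
    \<comment> \<open>As \<open>X\<close> normalises \<open>K\<close>, it preserves each level of
      the old flag.\<close>
    have XV: "X \<cdot> x \<in> V i" if "x \<in> V i" for i x
      using that
    proof (induction i arbitrary: x)
      case 0
      then show ?case using V0 by simp
    next
      case (Suc i)
      have "D \<cdot> X \<cdot> x \<in> V i" if "D \<in> K" for D
      proof -
        have "commutator D X \<cdot> x \<in> V i" using XK[OF that] Suc.prems VSuc by simp
        moreover have "X \<cdot> D \<cdot> x \<in> V i" using Suc.IH Suc.prems that VSuc by simp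
        ultimately have "commutator D X \<cdot> x + X \<cdot> D \<cdot> x \<in> V i" by (rule subspace_add[OF Vsub])
        then show ?thesis by (simp add: app_commutator)
      qed
      then show ?case using VSuc Suc.prems X(1) inv by simp
    qed
    \<comment> \<open>From \<open>V (Suc i)\<close>, \<open>K\<close> leads into \<open>V i\<close>
      while \<open>X\<close> acts nilpotently, so \<open>dimension\<close> further levels of the
      flag of \<open>K'\<close> are enough.\<close>
    have "\<exists>m'. V i \<subseteq> flag U K' m'" for i
    proof (induction i)
      case 0
      show ?case using V0 by (intro exI[of _ 0]) simp
    next
      case (Suc i)
      then obtain m' where m': "V i \<subseteq> flag U K' m'" by blast
      have main: "x \<in> flag U K' (m' + j)" if "x \<in> V (Suc i)" "(app X ^^ j) x = 0" for x j
        using that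
      proof (induction j arbitrary: x)
        case 0
        then show ?case using subspace_0[OF flag_sub[OF K'S]] by simp
      next
        case (Suc j)
        have "D \<cdot> x \<in> flag U K' (m' + j)" if "D \<in> K'" for D
        proof -
          obtain E c where D: "D = E + escale c X" and E: "E \<in> K"
            using \<open>D \<in> K'\<close> unfolding K'_def by blast
          have "E \<cdot> x \<in> V i" using Suc.prems(1) E VSuc by simp
          then have "E \<cdot> x \<in> flag U K' (m' + j)" using m' flag_mono[of m' "m' + j" K'] by auto
          moreover have "X \<cdot> x \<in> flag U K' (m' + j)"
            using Suc.IH[OF XV[OF Suc.prems(1)]] Suc.prems(2) by (simp add: funpow_swap1[of "app X"])
          ultimately show ?thesis unfolding D using flag_sub[OF K'S]
            by (auto intro!: subspace_add subspace_scale)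
        qed
        then show ?case using Suc.prems(1) VSuc by simp
      qed
      have "x \<in> flag U K' (m' + dimension)" if "x \<in> V (Suc i)" for x
      proof -
        have "x \<in> U" using that VSuc by simp
        then obtain k where "(app X ^^ k) x = 0" using nil X(1) by blast
        then have "(app X ^^ dimension) x = 0"
          using funpow_dimension_zero[OF lin_linear] X(1) S(2) by blast
        with that show ?thesis by (rule main)
      qed
      then show ?case by blast
    qed
    then have "\<exists>m'. U \<subseteq> flag U K' m'" using m by blast
    then have "good K'" unfolding good_def using KK0 KK' K'S K'sub K'br by blast
    moreover have "K \<subset> K'" using KK' \<open>X \<in> K'\<close> X(2) by blast
    ultimately show ?thesis by blast
  qed
  have "good K0" unfolding good_def
  proof (intro conjI)
    show "E.subspace K0" unfolding K0_def
      using S(1) by (intro E.subspaceI) (auto simp: E.subspace_0 E.subspace_add E.subspace_scale)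
    show "\<forall>D\<in>K0. \<forall>E\<in>K0. commutator D E \<in> K0" using S(3) by (auto simp: K0_def app_commutator)
    show "\<exists>m. U \<subseteq> flag U K0 m" by (rule exI[of _ 1]) (auto simp: K0_def)
  qed (auto simp: K0_def)
  have "good S"
  proof (rule ccontr)
    assume notS: "\<not> good S"
    \<comment> \<open>Otherwise the extensions continue forever, and one new operator from each
      forms a chain too long for \<open>lin\<close>.\<close>
    have "\<exists>K. \<forall>n. good (K n) \<and> K n \<subset> K (Suc n)"
      by (rule dependent_nat_choice) (use \<open>good K0\<close> good_extend notS in blast)+
    then obtain K where K: "\<And>n. good (K n)" "\<And>n. K n \<subset> K (Suc n)" by blast
    have Kmono: "K i \<subseteq> K j" if "i \<le> j" for i j
      by (rule lift_Suc_mono_le[OF _ that]) (use K(2) in blast)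
    have "\<forall>n. \<exists>X. X \<in> K (Suc n) - K n" using K(2) by blast
    then obtain X where X: "\<And>n. X n \<in> K (Suc n)" "\<And>n. X n \<notin> K n" by (metis DiffE)
    obtain F where F: "finite F" "lin \<subseteq> E.span F" by (rule lin_subset_span)
    have "Suc (card F) \<le> card F"
    proof (rule E.no_long_chain[OF F(1)])
      fix n
      show "X n \<in> E.span F" using X(1)[of n] K(1)[of "Suc n"] S(2) F(2) by (auto simp: good_def)
      have "E.subspace (K n)" using K(1) by (simp add: good_def)
      moreover have "X i \<in> K n" if "i < n" for i using X(1)[of i] Kmono[of "Suc i" n] that by auto
      ultimately have "E.span (X ` {..<n}) \<subseteq> K n" by (intro E.span_minimal) auto
      then show "X n \<notin> E.span (X ` {..<n})" using X(2) by blast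
    qed
    then show False by simp
  qed
  then obtain m where m: "U \<subseteq> flag U S m" by (auto simp: good_def)
  show ?thesis
  proof (rule ccontr)
    assume "\<not> ?thesis"
    then have "flag U S i \<subseteq> {0}" for i by (induction i) auto
    then show False using m U(2) by blast
  qed
qed

text \<open>The leading coefficient in \<open>t\<close> involves \<open>D\<close> alone; vanishing
  of the power of \<open>h + t D\<close> at \<open>x\<close> for enough values of \<open>t\<close>
  therefore passes to \<open>D\<close>.\<close>

lemma pencil_power_expansion:
  assumes "h \<in> lin" "D \<in> lin"
  shows "\<exists>c. c n = (app D ^^ n) x \<and> (\<forall>t. (app (h + escale t D) ^^ n) x = (\<Sum>i\<le>n. t ^ i *s c i))"
proof (induction n)
  case 0
  show ?case by (rule exI[of _ "\<lambda>_. x"]) simp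
next
  case (Suc n)
  then obtain c where c: "c n = (app D ^^ n) x"
    "\<And>t. (app (h + escale t D) ^^ n) x = (\<Sum>i\<le>n. t ^ i *s c i)" by blast
  define d where "d i = (if i \<le> n then h \<cdot> c i else 0) + (if i = 0 then 0 else D \<cdot> c (i - 1))" for i
  have "(app (h + escale t D) ^^ Suc n) x = (\<Sum>i\<le>Suc n. t ^ i *s d i)" for t
  proof -
    have "(app (h + escale t D) ^^ Suc n) x
        = (\<Sum>i\<le>n. t ^ i *s h \<cdot> c i) + (\<Sum>i\<le>n. t ^ Suc i *s D \<cdot> c i)"
      by (simp add: c(2) app_sum_right lin_scale[OF assms(1)] lin_scale[OF assms(2)]
          scale_sum_right sum.distrib mult.commute)
    also have "(\<Sum>i\<le>n. t ^ i *s h \<cdot> c i) = (\<Sum>i\<le>Suc n. t ^ i *s (if i \<le> n then h \<cdot> c i else 0))"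
      by simp
    also have "(\<Sum>i\<le>n. t ^ Suc i *s D \<cdot> c i)
        = (\<Sum>i\<le>Suc n. t ^ i *s (if i = 0 then 0 else D \<cdot> c (i - 1)))"
      by (subst sum.atMost_Suc_shift) simp
    finally show ?thesis by (simp only: d_def scale_right_distrib sum.distrib)
  qed
  moreover have "d (Suc n) = (app D ^^ Suc n) x" using c(1) by (simp add: d_def)
  ultimately show ?case by blast
qed

text \<open>For \<open>D\<close> in the null component of \<open>commutator h\<close> and
  \<open>t\<close> a large power of two, \<open>h + t D\<close> is still injective on the complement
  \<open>V1\<close>, so its generalised null space lies in \<open>V0\<close> and equals it by
  minimality. Hence its power of exponent \<open>dimension\<close> vanishes on \<open>V0\<close> for
  all these \<open>t\<close>, and so does that of \<open>D\<close>.\<close>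

lemma exists_regular_pair:
  assumes L: "E.subspace L" "L \<subseteq> lin" "\<And>D E. D \<in> L \<Longrightarrow> E \<in> L \<Longrightarrow> commutator D E \<in> L"
    and singular: "\<And>D. D \<in> L \<Longrightarrow> \<exists>x. x \<noteq> 0 \<and> D \<cdot> x = 0"
  obtains h x where "h \<in> L" "x \<noteq> 0" "\<And>D. D \<in> L \<Longrightarrow> D \<in> E.gen_eig (commutator h) 0 \<Longrightarrow> D \<cdot> x = 0"
proof -
  have "\<exists>h. h \<in> L \<and> (\<forall>D. D \<in> L \<longrightarrow> dim (gen_eig (app h) 0) \<le> dim (gen_eig (app D) 0))"
    by (rule ex_has_least_nat[where m = "\<lambda>D. dim (gen_eig (app D) 0)"]) (rule E.subspace_0[OF L(1)])
  then obtain h where h: "h \<in> L"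
    and min: "\<And>D. D \<in> L \<Longrightarrow> dim (gen_eig (app h) 0) \<le> dim (gen_eig (app D) 0)" by blast
  have hlin: "h \<in> lin" using h L(2) by blast
  \<comment> \<open>Fitting decomposition for \<open>h\<close>: nilpotent on \<open>V0\<close>,
    bijective on \<open>V1\<close>.\<close>
  define V0 where "V0 = gen_eig (app h) 0"
  define V1 where "V1 = span (\<Union>c\<in>- {0}. gen_eig (app h) c)"
  have V0sub: "subspace V0" unfolding V0_def by (rule subspace_gen_eig[OF lin_linear[OF hlin]])
  have V1sub: "subspace V1" unfolding V1_def by simp
  have L0_V0: "D \<cdot> x \<in> V0" if "D \<in> L" "D \<in> E.gen_eig (commutator h) 0" "x \<in> V0" for D x
    using gen_eig_app[OF hlin _ that(2), of x 0] that L(2) unfolding V0_def by auto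
  have L0_V1: "D \<cdot> x \<in> V1" if D: "D \<in> L" "D \<in> E.gen_eig (commutator h) 0" and x: "x \<in> V1" for D x
  proof -
    have Dlin: "D \<in> lin" using D L(2) by blast
    have "subspace {x. D \<cdot> x \<in> V1}"
      using V1sub by (intro subspaceI) (auto simp: subspace_0 subspace_add subspace_scale lin_scale[OF Dlin])
    moreover have "D \<cdot> x \<in> V1" if "x \<in> gen_eig (app h) c" "c \<noteq> 0" for x c
      using gen_eig_app[OF hlin Dlin D(2) that(1)] that(2) unfolding V1_def by (intro span_base) auto
    ultimately have "V1 \<subseteq> {x. D \<cdot> x \<in> V1}" by (subst (1) V1_def, intro span_minimal) auto
    with x show ?thesis by blast
  qed
  have h0: "h \<in> E.gen_eig (commutator h) 0"
    by (rule E.gen_eigI[where k = 1]) (simp add: commutator_def)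
  have surj: "\<exists>u\<in>V1. h \<cdot> u = x" if "x \<in> V1" for x
  proof -
    have "subspace {x. \<exists>u\<in>V1. h \<cdot> u = x}"
    proof (rule subspaceI)
      show "0 \<in> {x. \<exists>u\<in>V1. h \<cdot> u = x}" using subspace_0[OF V1sub] by force
    next
      fix x y assume "x \<in> {x. \<exists>u\<in>V1. h \<cdot> u = x}" "y \<in> {x. \<exists>u\<in>V1. h \<cdot> u = x}"
      then obtain u v where "u \<in> V1" "v \<in> V1" "h \<cdot> u = x" "h \<cdot> v = y" by blast
      then show "x + y \<in> {x. \<exists>u\<in>V1. h \<cdot> u = x}"
        using subspace_add[OF V1sub] by (intro CollectI bexI[of _ "u + v"]) auto
    next
      fix c x assume "x \<in> {x. \<exists>u\<in>V1. h \<cdot> u = x}"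
      then obtain u where "u \<in> V1" "h \<cdot> u = x" by blast
      then show "c *s x \<in> {x. \<exists>u\<in>V1. h \<cdot> u = x}"
        using subspace_scale[OF V1sub] lin_scale[OF hlin] by (intro CollectI bexI[of _ "c *s u"]) auto
    qed
    moreover have "\<exists>u\<in>V1. h \<cdot> u = x" if "x \<in> gen_eig (app h) c" "c \<noteq> 0" for x c
    proof -
      have "\<exists>u\<in>UNIV \<inter> gen_eig (app h) c. h \<cdot> u - 0 *s u = x"
        by (rule gen_eig_shift_surj[OF lin_linear[OF hlin] subspace_UNIV UNIV_I UNIV_I that])
      then obtain u where "u \<in> gen_eig (app h) c" "h \<cdot> u = x" by auto
      then show ?thesis using that(2) unfolding V1_def by (intro bexI[of _ u] span_base) auto
    qed
    ultimately have "V1 \<subseteq> {x. \<exists>u\<in>V1. h \<cdot> u = x}" by (subst (1) V1_def, intro span_minimal) auto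
    with that show ?thesis by blast
  qed
  have hinj: "x = 0" if x: "x \<in> V1" "h \<cdot> x = 0" for x
  proof (rule ccontr)
    assume "x \<noteq> 0"
    \<comment> \<open>By surjectivity a nonzero null vector in \<open>V1\<close> would start an
      infinite chain of preimages.\<close>
    have "\<exists>y. \<forall>n. (y n \<in> V1 \<and> (n = 0 \<longrightarrow> y n = x)) \<and> h \<cdot> y (Suc n) = y n"
      by (rule dependent_nat_choice) (use x surj in auto)
    then obtain y where "y 0 = x" "\<And>n. h \<cdot> y (Suc n) = 1 *s y n" by auto
    then show False
      using no_infinite_preimage_chain[OF lin_linear[OF hlin], of y "\<lambda>_. 1"] x(2) \<open>x \<noteq> 0\<close> by auto
  qed
  have disjoint: "x = 0" if "x \<in> V0" "x \<in> V1" for x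
  proof -
    obtain k where "(app h ^^ k) x = 0" using \<open>x \<in> V0\<close> unfolding V0_def gen_eig_0_iff by blast
    then show ?thesis using that(2)
    proof (induction k arbitrary: x)
      case (Suc k)
      have "h \<cdot> x = 0"
        by (rule Suc.IH) (use Suc.prems L0_V1[OF h h0] in \<open>auto simp: funpow_swap1[of "app h"]\<close>)
      then show ?case using hinj Suc.prems(2) by blast
    qed simp
  qed
  have decomp: "\<exists>x0\<in>V0. \<exists>x1\<in>V1. x = x0 + x1" for x
  proof -
    have "x \<in> span (UNIV \<inter> (\<Union>c. gen_eig (app h) c))"
      by (rule span_gen_eig[OF lin_linear[OF hlin] _ _ _ finite_Basis]) (auto simp: Basis_span)
    also have "\<dots> \<subseteq> span (V0 \<union> (\<Union>c\<in>- {0}. gen_eig (app h) c))"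
      unfolding V0_def by (intro span_mono) auto
    also have "\<dots> = {x + y | x y. x \<in> span V0 \<and> y \<in> V1}" unfolding V1_def by (rule span_Un)
    finally show ?thesis using V0sub by (auto simp: span_eq_iff[THEN iffD2])
  qed
  have nil: "\<exists>k. (app D ^^ k) x = 0" if D: "D \<in> L" "D \<in> E.gen_eig (commutator h) 0" and x: "x \<in> V0" for D x
  proof -
    have Dlin: "D \<in> lin" using D L(2) by blast
    define T where "T k = h + escale (2 ^ k) D" for k :: nat
    have "finite {c. \<exists>x\<in>V1. x \<noteq> 0 \<and> D \<cdot> x = c *s h \<cdot> x}"
      by (rule finite_pencil_eigenvalues[OF lin_linear[OF hlin] lin_linear[OF Dlin] V1sub hinj])
    moreover have "inj (\<lambda>k::nat. - inverse (2 ^ k) :: complex)"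
    proof (rule injI)
      fix i j :: nat assume "- inverse (2 ^ i) = - inverse (2 ^ j :: complex)"
      then have "of_nat (2 ^ i) = (of_nat (2 ^ j) :: complex)" by simp
      then have "(2::nat) ^ i = 2 ^ j" by (simp only: of_nat_eq_iff)
      then show "i = j" by simp
    qed
    ultimately have "finite ((\<lambda>k::nat. - inverse (2 ^ k)) -` {c. \<exists>x\<in>V1. x \<noteq> 0 \<and> D \<cdot> x = c *s h \<cdot> x})"
      by (rule finite_vimageI)
    \<comment> \<open>\<open>T k\<close> kills a nonzero \<open>y\<close> in \<open>V1\<close> only
      if \<open>D \<cdot> y\<close> is \<open>- inverse (2 ^ k)\<close> times
      \<open>h \<cdot> y\<close>, which happens for finitely many \<open>k\<close>.\<close>
    then obtain k0 where k0: "\<And>k x. k \<ge> k0 \<Longrightarrow> x \<in> V1 \<Longrightarrow> x \<noteq> 0 \<Longrightarrow> D \<cdot> x \<noteq> (- inverse (2 ^ k)) *s h \<cdot> x"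
      unfolding finite_nat_set_iff_bounded by (fastforce simp: not_less[symmetric])
    have "(app (T k) ^^ dimension) x = 0" if k: "k \<ge> k0" for k
    proof -
      have TL: "T k \<in> L" unfolding T_def
        using D h L(1) by (intro E.subspace_add E.subspace_scale) auto
      have Tlin: "T k \<in> lin" using TL L(2) by blast
      have T_V0: "T k \<cdot> y \<in> V0" if "y \<in> V0" for y
        unfolding T_def using that L0_V0[OF D] L0_V0[OF h h0] V0sub by (simp add: subspace_add subspace_scale)
      have T_V1: "T k \<cdot> y \<in> V1" if "y \<in> V1" for y
        unfolding T_def using that L0_V1[OF D] L0_V1[OF h h0] V1sub by (simp add: subspace_add subspace_scale)
      have T_inj: "y = 0" if y: "y \<in> V1" "T k \<cdot> y = 0" for y
      proof (rule ccontr)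
        assume "y \<noteq> 0"
        have "2 ^ k *s D \<cdot> y = - (h \<cdot> y)" using y(2) unfolding T_def by (simp add: eq_neg_iff_add_eq_0 add.commute)
        then have "inverse (2 ^ k) *s (2 ^ k *s D \<cdot> y) = inverse (2 ^ k) *s (- (h \<cdot> y))" by simp
        then have "D \<cdot> y = (- inverse (2 ^ k)) *s h \<cdot> y" by simp
        then show False using k0[OF k y(1) \<open>y \<noteq> 0\<close>] by blast
      qed
      have T_inj': "y = 0" if "y \<in> V1" "(app (T k) ^^ j) y = 0" for y j
        using that
      proof (induction j arbitrary: y)
        case (Suc j)
        have "T k \<cdot> y = 0"
          by (rule Suc.IH) (use Suc.prems T_V1 in \<open>auto simp: funpow_swap1[of "app (T k)"]\<close>)
        then show ?case using T_inj Suc.prems(1) by blast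
      qed simp
      have "gen_eig (app (T k)) 0 \<subseteq> V0"
      proof
        fix y assume "y \<in> gen_eig (app (T k)) 0"
        then obtain j where j: "(app (T k) ^^ j) y = 0" by (auto simp: gen_eig_0_iff)
        obtain y0 y1 where y: "y0 \<in> V0" "y1 \<in> V1" "y = y0 + y1" using decomp by blast
        have m0: "(app (T k) ^^ j) y0 \<in> V0" by (rule funpow_mem[OF y(1) T_V0])
        have m1: "(app (T k) ^^ j) y1 \<in> V1" by (rule funpow_mem[OF y(2) T_V1])
        have "(app (T k) ^^ j) y0 + (app (T k) ^^ j) y1 = 0"
          using j y(3) linearD(1)[OF linear_funpow[OF lin_linear[OF Tlin]]] by simp
        then have "(app (T k) ^^ j) y1 = - (app (T k) ^^ j) y0" by (simp add: eq_neg_iff_add_eq_0 add.commute)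
        then have "(app (T k) ^^ j) y1 \<in> V0" using m0 subspace_neg[OF V0sub] by simp
        then have "(app (T k) ^^ j) y1 = 0" using m1 disjoint by blast
        then have "y1 = 0" using T_inj' y(2) by blast
        then show "y \<in> V0" using y by simp
      qed
      \<comment> \<open>Here the choice of \<open>h\<close> enters: the inclusion and the reverse
        dimension inequality give equality.\<close>
      then have "gen_eig (app (T k)) 0 = V0"
        using min[OF TL] V0sub subspace_gen_eig[OF lin_linear[OF Tlin]]
        by (intro subspace_dim_equal) (auto simp: V0_def)
      then have "x \<in> gen_eig (app (T k)) 0" using x by simp
      then show ?thesis
        using funpow_dimension_zero[OF lin_linear[OF Tlin]] by (auto simp: gen_eig_0_iff)
    qed
    moreover obtain c where c: "c dimension = (app D ^^ dimension) x"
      "\<And>t. (app (h + escale t D) ^^ dimension) x = (\<Sum>i\<le>dimension. t ^ i *s c i)"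
      using pencil_power_expansion[OF hlin Dlin] by blast
    ultimately have "(\<Sum>i\<le>dimension. (2 ^ k) ^ i *s c i) \<in> {0}" if "k \<ge> k0" for k
      using that by (simp add: T_def)
    then have "c dimension \<in> {0}"
      by (rule coefficients_in_subspace[OF subspace_single_0 _ order_refl])
    then show ?thesis using c(1) by auto
  qed
  have "\<exists>x\<in>V0. x \<noteq> 0 \<and> (\<forall>D\<in>L \<inter> E.gen_eig (commutator h) 0. D \<cdot> x = 0)"
  proof (rule engel[OF V0sub])
    obtain x where "x \<noteq> 0" "h \<cdot> x = 0" using singular h by blast
    moreover from this have "x \<in> V0" unfolding V0_def gen_eig_0_iff by (intro exI[of _ 1]) simp
    ultimately show "\<exists>x\<in>V0. x \<noteq> 0" by blast
    have sub: "E.subspace (E.gen_eig (commutator h) 0)" by (rule E.subspace_gen_eig[OF linear_commutator[OF hlin]])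
    show "E.subspace (L \<inter> E.gen_eig (commutator h) 0)" by (rule E.subspace_inter[OF L(1) sub])
    show "L \<inter> E.gen_eig (commutator h) 0 \<subseteq> lin" using L(2) by blast
    show "commutator D X \<in> L \<inter> E.gen_eig (commutator h) 0"
      if "D \<in> L \<inter> E.gen_eig (commutator h) 0" "X \<in> L \<inter> E.gen_eig (commutator h) 0" for D X
    proof
      show "commutator D X \<in> L" using that L(3) by blast
      show "commutator D X \<in> E.gen_eig (commutator h) 0" unfolding commutator_def[of D X]
        using that by (intro E.subspace_diff[OF sub] gen_eig_commutator_0_mult) auto
    qed
    show "D \<cdot> x \<in> V0" if "D \<in> L \<inter> E.gen_eig (commutator h) 0" "x \<in> V0" for D x using that L0_V0 by blast
    show "\<exists>k. (app D ^^ k) x = 0" if "D \<in> L \<inter> E.gen_eig (commutator h) 0" "x \<in> V0" for D x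
      using that nil by blast
  qed
  then show ?thesis using that h by blast
qed

end

section \<open>Local maps and formal power series\<close>

text \<open>The library derivative of power series is not available in a ring without \<open>of_nat\<close>; the sum is
  \<open>Suc n\<close> copies of the coefficient.\<close>

definition formal_deriv :: "'a::ring fps \<Rightarrow> 'a fps" where
  "formal_deriv f = Abs_fps (\<lambda>n. \<Sum>i<Suc n. f $ Suc n)"

lemma formal_deriv_nth: "formal_deriv f $ n = (\<Sum>i<Suc n. f $ Suc n)"
  by (simp add: formal_deriv_def)

lemma formal_deriv_diff: "formal_deriv (f - g) = formal_deriv f - formal_deriv g"
  by (rule fps_ext) (simp add: formal_deriv_nth sum_subtractf del: sum.lessThan_Suc)

lemma formal_deriv_mult: "formal_deriv (f * g) = formal_deriv f * g + f * formal_deriv g"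
proof (rule fps_ext)
  fix n
  define N :: "nat \<Rightarrow> 'a \<Rightarrow> 'a" where "N k x = (\<Sum>i<k. x)" for k x
  have N_mult: "N k (x * y) = N k x * y" "N k (x * y) = x * N k y" for k x y
    by (simp_all add: N_def sum_distrib_left sum_distrib_right)
  have N_add: "N (k + l) x = N k x + N l x" for k l x
    by (induction l) (simp_all add: N_def add_ac)
  have "formal_deriv (f * g) $ n = N (Suc n) ((f * g) $ Suc n)"
    by (simp add: formal_deriv_nth N_def)
  also have "\<dots> = (\<Sum>i\<le>Suc n. N (Suc n) (f $ i * g $ (Suc n - i)))"
    unfolding fps_mult_nth atMost_atLeast0 N_def by (rule sum.swap)
  also have "\<dots> = (\<Sum>i\<le>Suc n. N i (f $ i) * g $ (Suc n - i) + f $ i * N (Suc n - i) (g $ (Suc n - i)))"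
  proof (rule sum.cong[OF refl])
    fix i assume "i \<in> {..Suc n}"
    then have "N (Suc n) (f $ i * g $ (Suc n - i)) = N (i + (Suc n - i)) (f $ i * g $ (Suc n - i))" by simp
    also have "\<dots> = N i (f $ i) * g $ (Suc n - i) + f $ i * N (Suc n - i) (g $ (Suc n - i))"
      unfolding N_add using N_mult(1)[of i] N_mult(2)[of "Suc n - i"] by simp
    finally show "N (Suc n) (f $ i * g $ (Suc n - i))
      = N i (f $ i) * g $ (Suc n - i) + f $ i * N (Suc n - i) (g $ (Suc n - i))" .
  qed
  also have "\<dots> = (\<Sum>i\<le>Suc n. N i (f $ i) * g $ (Suc n - i))
      + (\<Sum>i\<le>Suc n. f $ i * N (Suc n - i) (g $ (Suc n - i)))"
    by (rule sum.distrib)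
  also have "(\<Sum>i\<le>Suc n. N i (f $ i) * g $ (Suc n - i)) = (formal_deriv f * g) $ n"
    by (subst sum.atMost_Suc_shift)
      (simp add: fps_mult_nth atMost_atLeast0 formal_deriv_nth N_def[of 0] N_def[of "Suc _"]
        del: sum.lessThan_Suc)
  also have "(\<Sum>i\<le>Suc n. f $ i * N (Suc n - i) (g $ (Suc n - i))) = (f * formal_deriv g) $ n"
  proof -
    have "(\<Sum>i\<le>Suc n. f $ i * N (Suc n - i) (g $ (Suc n - i)))
        = (\<Sum>i\<le>n. f $ i * N (Suc n - i) (g $ (Suc n - i)))"
      by (simp add: N_def)
    also have "\<dots> = (\<Sum>i\<le>n. f $ i * formal_deriv g $ (n - i))"
      by (rule sum.cong) (auto simp: formal_deriv_nth N_def Suc_diff_le)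
    finally show ?thesis by (simp add: fps_mult_nth atMost_atLeast0)
  qed
  finally show "formal_deriv (f * g) $ n = (formal_deriv f * g + f * formal_deriv g) $ n" by simp
qed

lemma formal_deriv_const: "formal_deriv (fps_const c) = 0"
  by (rule fps_ext) (simp add: formal_deriv_nth)

text \<open>Regroups by total degree the product of two exponential sums that are finite by
  nilpotency; \<open>2 * m\<close> lies past every nonzero term.\<close>

lemma triangle_eq_square:
  fixes q :: "nat \<Rightarrow> nat \<Rightarrow> 'b::comm_monoid_add"
  assumes "\<And>i j. i \<ge> m \<or> j \<ge> m \<Longrightarrow> q i j = 0"
  shows "(\<Sum>k\<le>2 * m. \<Sum>i\<le>k. q i (k - i)) = (\<Sum>i<m. \<Sum>j<m. q i j)"
proof -
  have "(\<Sum>k\<le>2 * m. \<Sum>i\<le>k. q i (k - i)) = (\<Sum>(i, j)\<in>{(i, j). i + j \<le> 2 * m}. q i j)"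
    by (rule sum.triangle_reindex_eq[symmetric])
  also have "\<dots> = (\<Sum>(i, j)\<in>{..<m} \<times> {..<m}. q i j)"
  proof (rule sum.mono_neutral_right)
    show "finite {(i, j). i + j \<le> 2 * m}"
      by (rule finite_subset[of _ "{..2 * m} \<times> {..2 * m}"]) auto
    show "\<forall>ij\<in>{(i, j). i + j \<le> 2 * m} - {..<m} \<times> {..<m}. (case ij of (i, j) \<Rightarrow> q i j) = 0"
    proof
      fix ij assume "ij \<in> {(i, j). i + j \<le> 2 * m} - {..<m} \<times> {..<m}"
      then show "(case ij of (i, j) \<Rightarrow> q i j) = 0"
        using assms[of "fst ij" "snd ij"] by (cases ij) (auto simp: not_less)
    qed
  qed auto
  finally show ?thesis by (simp add: sum.cartesian_product)
qed

context fin_dim_complex_space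
begin

section \<open>Operator differential equations and conjugation by exponentials\<close>

lemma formal_deriv_nth': "formal_deriv (f :: 'a endo fps) $ n = escale (of_nat (Suc n)) (f $ Suc n)"
  unfolding formal_deriv_nth E.sum_constant_scale by simp

text \<open>The equation determines each coefficient from the lower ones. Identities of operator
  series are proved below by checking that the difference of the two sides satisfies such an
  equation.\<close>

lemma formal_ode_zero:
  fixes F :: "'a endo fps"
  assumes "formal_deriv F = F * b - c * F" "F $ 0 = 0"
  shows "F = 0"
proof (rule fps_ext)
  fix n
  show "F $ n = 0 $ n"
  proof (induction n rule: less_induct)
    case (less n)
    show ?case
    proof (cases n)
      case (Suc m)
      have "escale (of_nat (Suc m)) (F $ Suc m) = (F * b - c * F) $ m"
        unfolding assms(1)[symmetric] formal_deriv_nth' ..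
      also have "\<dots> = 0" using less Suc by (simp add: fps_mult_nth)
      finally show ?thesis using Suc by (simp del: of_nat_Suc)
    qed (use assms(2) in simp)
  qed
qed

definition exp_coeff :: "'a endo \<Rightarrow> nat \<Rightarrow> 'a endo" where
  "exp_coeff A k = escale (1 / fact k) (A ^ k)"

text \<open>The coefficients of \<open>exp (- t A) D exp (t A)\<close>.\<close>

primrec conj_coeff :: "'a endo \<Rightarrow> 'a endo \<Rightarrow> nat \<Rightarrow> 'a endo" where
  "conj_coeff A D 0 = D"
| "conj_coeff A D (Suc k) = escale (1 / of_nat (Suc k)) (commutator (conj_coeff A D k) A)"

lemma formal_deriv_exp_coeff:
  "formal_deriv (Abs_fps (exp_coeff A)) = Abs_fps (exp_coeff A) * fps_const A"
proof (rule fps_ext)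
  fix n
  have "escale (of_nat (Suc n)) (exp_coeff A (Suc n)) = exp_coeff A n * A"
    by (simp add: exp_coeff_def escale_mult power_commutes divide_simps del: of_nat_Suc)
  then show "formal_deriv (Abs_fps (exp_coeff A)) $ n = (Abs_fps (exp_coeff A) * fps_const A) $ n"
    unfolding formal_deriv_nth' by simp
qed

lemma exp_coeff_commute: "A \<in> lin \<Longrightarrow> A * exp_coeff A k = exp_coeff A k * A"
  by (simp add: exp_coeff_def escale_mult mult_escale power_commutes)

text \<open>With \<open>P\<close> and \<open>Q\<close> the series of \<open>exp (t A)\<close> and
  \<open>exp (- t A)\<close>, both \<open>Q D P\<close> and the series of \<open>conj_coeff\<close>
  solve \<open>C' = C A - A C\<close> with value \<open>D\<close> at \<open>0\<close>.\<close>

lemma conj_coeff_eq: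
  assumes A: "A \<in> lin"
  shows "conj_coeff A D k = (\<Sum>i\<le>k. exp_coeff (- A) i * D * exp_coeff A (k - i))"
proof -
  define P where "P = Abs_fps (exp_coeff A)"
  define Q where "Q = Abs_fps (exp_coeff (- A))"
  define C where "C = Abs_fps (conj_coeff A D)"
  have dP: "formal_deriv P = P * fps_const A" unfolding P_def by (rule formal_deriv_exp_coeff)
  have "Q * fps_const (- A) = - (fps_const A * Q)"
    using exp_coeff_commute[of "- A"] E.subspace_neg[OF subspace_lin A]
    by (intro fps_ext) (simp add: Q_def)
  then have dQ: "formal_deriv Q = - (fps_const A * Q)"
    using formal_deriv_exp_coeff[of "- A"] by (simp add: Q_def)
  have dC: "formal_deriv C = C * fps_const A - fps_const A * C"
    by (rule fps_ext) (simp add: formal_deriv_nth' C_def commutator_def del: of_nat_Suc)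
  have "Q * fps_const D * P - C = 0"
  proof (rule formal_ode_zero)
    show "formal_deriv (Q * fps_const D * P - C)
        = (Q * fps_const D * P - C) * fps_const A - fps_const A * (Q * fps_const D * P - C)"
      by (simp add: formal_deriv_diff formal_deriv_mult formal_deriv_const dP dQ dC algebra_simps)
    show "(Q * fps_const D * P - C) $ 0 = 0"
      by (simp add: P_def Q_def C_def exp_coeff_def escale_def)
         (auto intro!: endo_eqI)
  qed
  then have "C $ k = (Q * fps_const D * P) $ k" by simp
  then show ?thesis
    by (simp add: C_def fps_mult_nth[of "Q * fps_const D"] atMost_atLeast0) (simp add: P_def Q_def)
qed

section \<open>The reflexive closure of a Lie algebra of operators\<close>

definition loc :: "'a endo set \<Rightarrow> 'a endo set" where
  "loc L = {D \<in> lin. \<forall>x. \<exists>E\<in>L. D \<cdot> x = E \<cdot> x}"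

lemma subset_loc: "L \<subseteq> lin \<Longrightarrow> L \<subseteq> loc L"
  by (auto simp: loc_def)

lemma subspace_orbit: "E.subspace L \<Longrightarrow> subspace ((\<lambda>D. D \<cdot> x) ` L)"
proof (rule subspaceI)
  assume L: "E.subspace L"
  show "0 \<in> (\<lambda>D. D \<cdot> x) ` L" using E.subspace_0[OF L] by (intro image_eqI[of _ _ 0]) auto
  show "y + z \<in> (\<lambda>D. D \<cdot> x) ` L" if yz: "y \<in> (\<lambda>D. D \<cdot> x) ` L" "z \<in> (\<lambda>D. D \<cdot> x) ` L" for y z
  proof -
    obtain D E where "D \<in> L" "E \<in> L" "y = D \<cdot> x" "z = E \<cdot> x" using yz by blast
    then show ?thesis using E.subspace_add[OF L] by (intro image_eqI[of _ _ "D + E"]) auto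
  qed
  show "c *s y \<in> (\<lambda>D. D \<cdot> x) ` L" if y: "y \<in> (\<lambda>D. D \<cdot> x) ` L" for c y
  proof -
    obtain D where "D \<in> L" "y = D \<cdot> x" using y by blast
    then show ?thesis using E.subspace_scale[OF L] by (intro image_eqI[of _ _ "escale c D"]) auto
  qed
qed

lemma loc_iff: "D \<in> loc L \<longleftrightarrow> D \<in> lin \<and> (\<forall>x. D \<cdot> x \<in> (\<lambda>D. D \<cdot> x) ` L)"
  by (auto simp: loc_def)

lemma subspace_loc:
  assumes L: "E.subspace L"
  shows "E.subspace (loc L)"
  using subspace_lin subspace_orbit[OF L]
  by (intro E.subspaceI)
    (auto simp: loc_iff simp del: image_iff intro: E.subspace_0 E.subspace_add E.subspace_scale
      subspace_0 subspace_add subspace_scale)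

text \<open>For every \<open>t\<close>, \<open>exp (- t A) \<Delta> exp (t A) x\<close> lies in the subspace \<open>L x\<close>, because conjugation by
  \<open>exp (t A)\<close> preserves \<open>L\<close>. As it is a polynomial in \<open>t\<close>, its linear coefficient lies there too.\<close>

lemma loc_commutator_nilpotent:
  assumes L: "E.subspace L" "L \<subseteq> lin" "\<And>D E. D \<in> L \<Longrightarrow> E \<in> L \<Longrightarrow> commutator D E \<in> L"
    and A: "A \<in> L" "A ^ m = 0" and \<Delta>: "\<Delta> \<in> loc L"
  shows "commutator \<Delta> A \<in> loc L"
proof -
  have Alin: "A \<in> lin" and \<Delta>lin: "\<Delta> \<in> lin" using A(1) L(2) \<Delta> by (auto simp: loc_def)
  have exp_lin: "exp_coeff B k \<in> lin" if "B \<in> lin" for B k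
  proof -
    have "B ^ k \<in> lin" by (induction k) (use that lin_mult in \<open>auto simp: lin_def\<close>)
    then show ?thesis unfolding exp_coeff_def by (rule E.subspace_scale[OF subspace_lin])
  qed
  have A0: "A ^ k = 0" if "k \<ge> m" for k
  proof -
    have "A ^ k = A ^ m * A ^ (k - m)" using that by (simp flip: power_add)
    then show ?thesis using A(2) by simp
  qed
  have mA0: "(- A) ^ k = 0" if "k \<ge> m" for k
  proof -
    have "(- A) ^ j = A ^ j \<or> (- A) ^ j = - (A ^ j)" for j by (induction j) auto
    then show ?thesis using A0[OF that] by (metis neg_0_equal_iff_equal)
  qed
  \<comment> \<open>\<open>P t\<close> and \<open>Q t\<close> are \<open>exp (t A)\<close> and
    \<open>exp (- t A)\<close>; the sums are finite because \<open>A\<close> is nilpotent.\<close>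
  define P where "P t x = (\<Sum>j<Suc m. t ^ j *s exp_coeff A j \<cdot> x)" for t x
  define Q where "Q t y = (\<Sum>i<Suc m. t ^ i *s exp_coeff (- A) i \<cdot> y)" for t y
  have key: "(\<Sum>k\<le>2 * Suc m. t ^ k *s conj_coeff A D k \<cdot> x) = Q t (D \<cdot> P t x)" if D: "D \<in> lin" for D t x
  proof -
    define q where "q i j = t ^ (i + j) *s exp_coeff (- A) i \<cdot> D \<cdot> exp_coeff A j \<cdot> x" for i j
    have "(\<Sum>k\<le>2 * Suc m. t ^ k *s conj_coeff A D k \<cdot> x) = (\<Sum>k\<le>2 * Suc m. \<Sum>i\<le>k. q i (k - i))"
      by (intro sum.cong refl) (simp add: conj_coeff_eq[OF Alin] app_sum scale_sum_right q_def)
    also have "\<dots> = (\<Sum>i<Suc m. \<Sum>j<Suc m. q i j)"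
    proof (rule triangle_eq_square)
      fix i j assume "i \<ge> Suc m \<or> j \<ge> Suc m"
      then have "exp_coeff (- A) i = 0 \<or> exp_coeff A j = 0" using A0 mA0 by (auto simp: exp_coeff_def)
      then show "q i j = 0" by (auto simp: q_def)
    qed
    also have "\<dots> = (\<Sum>i<Suc m. \<Sum>j<Suc m. t ^ i *s t ^ j *s exp_coeff (- A) i \<cdot> D \<cdot> exp_coeff A j \<cdot> x)"
      by (simp add: q_def power_add)
    also have "\<dots> = Q t (D \<cdot> P t x)"
      unfolding Q_def P_def app_sum_right scale_sum_right
      by (simp only: lin_scale[OF D] lin_scale[OF exp_lin[OF E.subspace_neg[OF subspace_lin Alin]]])
    finally show ?thesis .
  qed
  have conj_L: "conj_coeff A D k \<in> L" if "D \<in> L" for D k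
    by (induction k) (use that L A(1) E.subspace_scale in auto)
  have "commutator \<Delta> A \<cdot> x \<in> (\<lambda>D. D \<cdot> x) ` L" for x
  proof -
    have "conj_coeff A \<Delta> 1 \<cdot> x \<in> (\<lambda>D. D \<cdot> x) ` L"
    proof (rule coefficients_in_subspace[OF subspace_orbit[OF L(1)]])
      fix k :: nat
      define t :: complex where "t = 2 ^ k"
      \<comment> \<open>\<open>D\<close> depends on \<open>t\<close>, but it agrees with
        \<open>\<Delta>\<close> at the single vector \<open>P t x\<close>, which is all that
        \<open>key\<close> sees.\<close>
      obtain D where D: "D \<in> L" "\<Delta> \<cdot> P t x = D \<cdot> P t x" using \<Delta> unfolding loc_def by blast
      have "(\<Sum>k\<le>2 * Suc m. t ^ k *s conj_coeff A \<Delta> k \<cdot> x)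
          = (\<Sum>k\<le>2 * Suc m. t ^ k *s conj_coeff A D k \<cdot> x)"
        using key[OF \<Delta>lin] key[of D] D L(2) by auto
      also have "\<dots> \<in> (\<lambda>D. D \<cdot> x) ` L"
        by (intro subspace_sum[OF subspace_orbit[OF L(1)]] subspace_scale[OF subspace_orbit[OF L(1)]]
            imageI conj_L D(1))
      finally show "(\<Sum>i\<le>2 * Suc m. (2 ^ k) ^ i *s conj_coeff A \<Delta> i \<cdot> x) \<in> (\<lambda>D. D \<cdot> x) ` L"
        by (simp add: t_def)
    qed auto
    then show ?thesis by simp
  qed
  then show ?thesis using lin_commutator[OF \<Delta>lin Alin] by (simp add: loc_iff)
qed

text \<open>\<open>A\<close> raises generalised eigenvalues of \<open>h\<close> by
  \<open>a \<noteq> 0\<close>; iterates that never vanish would give infinitely many eigenvalues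
  \<open>of_nat j * a + c\<close> of \<open>h\<close>.\<close>

lemma gen_eig_nilpotent:
  assumes h: "h \<in> lin" and A: "A \<in> lin" "A \<in> E.gen_eig (commutator h) a" and "a \<noteq> 0"
  shows "A ^ dimension = 0"
proof (rule endo_eqI)
  fix x
  have "\<exists>j. (app A ^^ j) x = 0" if x: "x \<in> gen_eig (app h) c" for x c
  proof (rule ccontr)
    assume nz: "\<not> ?thesis"
    have mem: "(app A ^^ j) x \<in> gen_eig (app h) (of_nat j * a + c)" for j
    proof (induction j)
      case (Suc j)
      from gen_eig_app[OF h A this] show ?case by (simp add: algebra_simps)
    qed (use x in simp)
    have "of_nat j * a + c \<in> {c. \<exists>x\<in>UNIV. x \<noteq> 0 \<and> h \<cdot> x = c *s (1 :: 'a endo) \<cdot> x}" for j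
      using gen_eig_eigenvector[OF mem[of j]] nz by auto
    moreover have "finite {c. \<exists>x\<in>UNIV. x \<noteq> 0 \<and> h \<cdot> x = c *s (1 :: 'a endo) \<cdot> x}"
      by (rule finite_pencil_eigenvalues) (use h in \<open>auto simp del: app_simps(2) simp: lin_iff_linear[symmetric]\<close>, auto simp: lin_def)
    ultimately have "finite (range (\<lambda>j::nat. of_nat j * a + c))"
      using finite_subset[of "range (\<lambda>j::nat. of_nat j * a + c)"] by blast
    moreover have "inj (\<lambda>j::nat. of_nat j * a + c)" using \<open>a \<noteq> 0\<close> by (auto simp: inj_def)
    ultimately show False using finite_imageD by fastforce
  qed
  then have "(\<Union>c. gen_eig (app h) c) \<subseteq> gen_eig (app A) 0" by (auto simp: gen_eig_0_iff)
  then have "span (UNIV \<inter> (\<Union>c. gen_eig (app h) c)) \<subseteq> gen_eig (app A) 0"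
    using subspace_gen_eig[OF lin_linear[OF A(1)]] by (intro span_minimal) auto
  moreover have "x \<in> span (UNIV \<inter> (\<Union>c. gen_eig (app h) c))"
    by (rule span_gen_eig[OF lin_linear[OF h] _ _ _ finite_Basis]) (auto simp: Basis_span)
  ultimately have "x \<in> gen_eig (app A) 0" by blast
  then obtain k where "(app A ^^ k) x = 0" by (auto simp: gen_eig_0_iff)
  then have "(app A ^^ dimension) x = 0" by (rule funpow_dimension_zero[OF lin_linear[OF A(1)]])
  then show "(A ^ dimension) \<cdot> x = 0 \<cdot> x" by (simp add: app_power)
qed

text \<open>Power series \<open>a, d, m, g\<close> with \<open>g' = g a\<close>, \<open>d = g\<^sup>-\<^sup>1 \<Delta> g\<close> and \<open>m = g\<^sup>-\<^sup>1 (h + t \<Delta>) g\<close> are built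
  so that \<open>m x = 0\<close>; then \<open>g x\<close> is the null vector. In terms of \<open>a\<close>, they satisfy \<open>d' = [d, a]\<close> and
  \<open>m' = d + [m, a]\<close>, and the coefficients of \<open>a\<close> are chosen one at a time. The third component of
  \<open>f k\<close> below is the coefficient of \<open>m\<close> of index \<open>Suc k\<close>.\<close>

lemma formal_null_vector_sequence:
  assumes h: "h \<in> M" "h \<cdot> x = 0" and \<Delta>: "\<Delta> \<in> M"
    and M: "E.subspace M" and MN: "\<And>D A. D \<in> M \<Longrightarrow> A \<in> N \<Longrightarrow> commutator D A \<in> M"
    and surj: "\<And>D. D \<in> M \<Longrightarrow> \<exists>A\<in>N. h \<cdot> A \<cdot> x = D \<cdot> x"
  obtains y where "y 0 = x" "\<And>k. h \<cdot> y (Suc k) = - (\<Delta> \<cdot> y k)"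
proof -
  \<comment> \<open>In the last sum the summand with \<open>m 0 = h\<close> stands apart as
    \<open>commutator h a\<close>, so \<open>f i\<close> contributes the coefficient of
    \<open>m\<close> of index \<open>Suc i\<close>, paired with the coefficient of \<open>a\<close>
    of index \<open>k - 1 - i\<close>.\<close>
  define good where "good = (\<lambda>f k r. case r of (a, d, m) \<Rightarrow>
    a \<in> N \<and> d \<in> M \<and> m \<in> M \<and> m \<cdot> x = 0 \<and>
    d = (case k of 0 \<Rightarrow> \<Delta> | Suc j \<Rightarrow>
      escale (1 / of_nat (Suc j)) (\<Sum>i<k. commutator (fst (snd (f i))) (fst (f (k - 1 - i))))) \<and>
    m = escale (1 / of_nat (Suc k))
      (d + commutator h a + (\<Sum>i<k. commutator (snd (snd (f i))) (fst (f (k - 1 - i))))))"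
  have "\<exists>f. \<forall>k. good f k (f k)"
  proof (rule dependent_wellorder_choice)
    fix r :: "'a endo \<times> 'a endo \<times> 'a endo" and f g :: "nat \<Rightarrow> 'a endo \<times> 'a endo \<times> 'a endo" and k :: nat
    assume eq: "\<And>y. y < k \<Longrightarrow> f y = g y"
    have sums: "(\<Sum>i<k. commutator (fst (snd (f i))) (fst (f (k - 1 - i))))
        = (\<Sum>i<k. commutator (fst (snd (g i))) (fst (g (k - 1 - i))))"
      "(\<Sum>i<k. commutator (snd (snd (f i))) (fst (f (k - 1 - i))))
        = (\<Sum>i<k. commutator (snd (snd (g i))) (fst (g (k - 1 - i))))"
      by (auto intro!: sum.cong simp: eq)
    show "good f k r = good g k r" unfolding good_def sums by (rule refl)
  next
    fix k :: nat and f :: "nat \<Rightarrow> 'a endo \<times> 'a endo \<times> 'a endo"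
    assume prev: "\<And>y. y < k \<Longrightarrow> good f y (f y)"
    have fN: "fst (f i) \<in> N" and fM: "fst (snd (f i)) \<in> M" "snd (snd (f i)) \<in> M" if "i < k" for i
      using prev[OF that] by (auto simp: good_def split: prod.splits)
    define d where "d = (case k of 0 \<Rightarrow> \<Delta> | Suc j \<Rightarrow>
      escale (1 / of_nat (Suc j)) (\<Sum>i<k. commutator (fst (snd (f i))) (fst (f (k - 1 - i)))))"
    have dM: "d \<in> M" unfolding d_def
      using \<Delta> fN fM by (auto split: nat.split simp del: sum.lessThan_Suc intro!: E.subspace_scale[OF M] E.subspace_sum[OF M] MN)
    define w where "w = d + (\<Sum>i<k. commutator (snd (snd (f i))) (fst (f (k - 1 - i))))"
    have wM: "w \<in> M" unfolding w_def
      using fN fM by (intro E.subspace_add[OF M] dM E.subspace_sum[OF M] MN) auto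
    \<comment> \<open>Since \<open>h\<close> kills \<open>x\<close>, \<open>commutator h a\<close>
      sends \<open>x\<close> to \<open>h \<cdot> a \<cdot> x\<close>, so this choice of
      \<open>a\<close> makes the next coefficient of \<open>m\<close> kill \<open>x\<close>.\<close>
    obtain a where a: "a \<in> N" "h \<cdot> a \<cdot> x = - w \<cdot> x"
      using surj[OF E.subspace_neg[OF M wM]] by blast
    define m where "m = escale (1 / of_nat (Suc k)) (w + commutator h a)"
    have "m \<in> M" unfolding m_def by (intro E.subspace_scale[OF M] E.subspace_add[OF M] wM MN h a)
    moreover have "m \<cdot> x = 0" unfolding m_def using a h(2) by (simp add: app_commutator)
    ultimately have "good f k (a, d, m)" unfolding good_def
      using a(1) dM by (auto simp: d_def[symmetric] m_def w_def add_ac)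
    then show "\<exists>r. good f k r" by blast
  qed
  then obtain f where f: "\<And>k. good f k (f k)" by blast
  define a where "a k = fst (f k)" for k
  define d where "d k = fst (snd (f k))" for k
  define m where "m k = (case k of 0 \<Rightarrow> h | Suc j \<Rightarrow> snd (snd (f j)))" for k
  have d0: "d 0 = \<Delta>" using f[of 0] by (auto simp: good_def d_def split: prod.splits)
  have dSuc: "escale (of_nat (Suc k)) (d (Suc k)) = (\<Sum>i\<le>k. commutator (d i) (a (k - i)))" for k
  proof -
    have "d (Suc k) = escale (1 / of_nat (Suc k)) (\<Sum>i<Suc k. commutator (d i) (a (Suc k - 1 - i)))"
      using f[of "Suc k"] by (auto simp: good_def d_def a_def split: prod.splits)
    then show ?thesis by (simp add: lessThan_Suc_atMost del: of_nat_Suc)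
  qed
  have m0: "m 0 = h" by (simp add: m_def)
  have mx: "m k \<cdot> x = 0" for k
    using h(2) f[of "k - 1"] by (auto simp: m_def good_def split: prod.splits nat.split)
  have mSuc: "escale (of_nat (Suc k)) (m (Suc k)) = d k + (\<Sum>i\<le>k. commutator (m i) (a (k - i)))" for k
  proof -
    have "m (Suc k) = escale (1 / of_nat (Suc k))
        (d k + commutator h (a k) + (\<Sum>i<k. commutator (m (Suc i)) (a (k - 1 - i))))"
      using f[of k] by (auto simp: good_def d_def a_def m_def split: prod.splits)
    then have "escale (of_nat (Suc k)) (m (Suc k))
        = d k + (commutator h (a k) + (\<Sum>i<k. commutator (m (Suc i)) (a (k - 1 - i))))"
      by (simp add: add.assoc del: of_nat_Suc)
    also have "commutator h (a k) + (\<Sum>i<k. commutator (m (Suc i)) (a (k - 1 - i)))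
        = (\<Sum>i<Suc k. commutator (m i) (a (k - i)))"
      by (subst sum.lessThan_Suc_shift) (simp add: m0)
    finally show ?thesis by (simp only: lessThan_Suc_atMost)
  qed
  have "\<exists>g :: nat \<Rightarrow> 'a endo. \<forall>k. g k = (case k of 0 \<Rightarrow> 1 | Suc j \<Rightarrow>
      escale (1 / of_nat (Suc j)) (\<Sum>i<k. g i * a (k - 1 - i)))"
  proof (rule dependent_wellorder_choice)
    fix r :: "'a endo" and f g :: "nat \<Rightarrow> 'a endo" and k :: nat
    assume eq: "\<And>y. y < k \<Longrightarrow> f y = g y"
    have sums: "(\<Sum>i<k. f i * a (k - 1 - i)) = (\<Sum>i<k. g i * a (k - 1 - i))"
      by (auto intro!: sum.cong simp: eq)
    show "(r = (case k of 0 \<Rightarrow> 1 | Suc j \<Rightarrow>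
        escale (1 / of_nat (Suc j)) (\<Sum>i<k. f i * a (k - 1 - i))))
      = (r = (case k of 0 \<Rightarrow> 1 | Suc j \<Rightarrow>
        escale (1 / of_nat (Suc j)) (\<Sum>i<k. g i * a (k - 1 - i))))" unfolding sums by (rule refl)
  qed blast
  then obtain g :: "nat \<Rightarrow> 'a endo" where g: "\<And>k. g k = (case k of 0 \<Rightarrow> 1 | Suc j \<Rightarrow>
      escale (1 / of_nat (Suc j)) (\<Sum>i<k. g i * a (k - 1 - i)))" by blast
  have g0: "g 0 = 1" using g[of 0] by simp
  have gSuc: "escale (of_nat (Suc k)) (g (Suc k)) = (\<Sum>i\<le>k. g i * a (k - i))" for k
    using g[of "Suc k"] by (simp add: lessThan_Suc_atMost del: of_nat_Suc)
  define A where "A = Abs_fps a"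
  define W where "W = Abs_fps d"
  define R where "R = Abs_fps m"
  define G where "G = Abs_fps g"
  \<comment> \<open>\<open>H\<close> is the pencil \<open>h + t \<Delta>\<close>.\<close>
  define H where "H = Abs_fps (\<lambda>k. if k = 0 then h else if k = 1 then \<Delta> else 0)"
  have dW: "formal_deriv W = W * A - A * W"
  proof (rule fps_ext)
    fix k
    have "(A * W) $ k = (\<Sum>i\<le>k. a (k - i) * d i)"
      unfolding fps_mult_nth A_def W_def atMost_atLeast0
      by (subst sum.atLeastAtMost_rev) simp
    then show "formal_deriv W $ k = (W * A - A * W) $ k"
      by (simp add: formal_deriv_nth' W_def A_def dSuc commutator_def sum_subtractf
          fps_mult_nth atMost_atLeast0 del: of_nat_Suc)
  qed
  have dR: "formal_deriv R = W + R * A - A * R"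
  proof (rule fps_ext)
    fix k
    have "(A * R) $ k = (\<Sum>i\<le>k. a (k - i) * m i)"
      unfolding fps_mult_nth A_def R_def atMost_atLeast0
      by (subst sum.atLeastAtMost_rev) simp
    then show "formal_deriv R $ k = (W + R * A - A * R) $ k"
      by (simp add: formal_deriv_nth' W_def R_def A_def mSuc commutator_def sum_subtractf
          fps_mult_nth atMost_atLeast0 del: of_nat_Suc)
  qed
  have dG: "formal_deriv G = G * A"
    by (rule fps_ext)
      (simp add: formal_deriv_nth' G_def A_def gSuc fps_mult_nth atMost_atLeast0 del: of_nat_Suc)
  have dH: "formal_deriv H = fps_const \<Delta>"
    by (rule fps_ext) (simp add: formal_deriv_nth' H_def)
  \<comment> \<open>Both \<open>fps_const \<Delta> * G\<close> and \<open>G * W\<close> solve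
    \<open>F' = F * A\<close> with value \<open>\<Delta>\<close> at \<open>0\<close>. This identity
    in turn gives the equation for \<open>H * G - G * R\<close>.\<close>
  have "fps_const \<Delta> * G - G * W = 0"
  proof (rule formal_ode_zero)
    show "formal_deriv (fps_const \<Delta> * G - G * W) = (fps_const \<Delta> * G - G * W) * A - 0 * (fps_const \<Delta> * G - G * W)"
      by (simp add: formal_deriv_diff formal_deriv_mult formal_deriv_const dW dG algebra_simps)
    show "(fps_const \<Delta> * G - G * W) $ 0 = 0" by (simp add: G_def W_def g0 d0)
  qed
  then have \<Delta>G: "fps_const \<Delta> * G = G * W" by simp
  have "H * G - G * R = 0"
  proof (rule formal_ode_zero)
    show "formal_deriv (H * G - G * R) = (H * G - G * R) * A - 0 * (H * G - G * R)"
      by (simp add: formal_deriv_diff formal_deriv_mult dH dR dG \<Delta>G algebra_simps)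
    show "(H * G - G * R) $ 0 = 0" by (simp add: G_def R_def H_def g0 m0)
  qed
  then have HG: "H * G = G * R" by simp
  \<comment> \<open>Compare coefficients of \<open>H * G = G * R\<close> at \<open>x\<close>: the
    right side vanishes since every coefficient of \<open>R\<close> kills \<open>x\<close>.\<close>
  have "h \<cdot> g (Suc k) \<cdot> x = - (\<Delta> \<cdot> g k \<cdot> x)" for k
  proof -
    have "(H * G) $ Suc k = (\<Sum>i\<le>Suc k. H $ i * g (Suc k - i))"
      by (simp add: fps_mult_nth atMost_atLeast0 G_def)
    also have "\<dots> = (\<Sum>i\<in>{0, 1}. H $ i * g (Suc k - i))"
      by (rule sum.mono_neutral_right) (auto simp: H_def)
    also have "\<dots> = h * g (Suc k) + \<Delta> * g k" by (simp add: H_def)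
    finally have "(h * g (Suc k) + \<Delta> * g k) \<cdot> x = ((G * R) $ Suc k) \<cdot> x" using HG by simp
    also have "\<dots> = 0" by (simp add: fps_mult_nth R_def app_sum mx)
    finally show ?thesis by (simp add: eq_neg_iff_add_eq_0)
  qed
  then show ?thesis using that[of "\<lambda>k. g k \<cdot> x"] g0 by simp
qed

end

section \<open>Invertible local maps\<close>

context fin_dim_complex_space
begin

text \<open>The formal construction is applied with \<open>M = loc L\<close> and with
  \<open>N\<close> spanned by the operators of nonzero weight in \<open>L\<close>. These are
  nilpotent, so commutators with them preserve \<open>loc L\<close>; and as the operators of weight
  zero kill \<open>x\<close>, the vectors \<open>h \<cdot> A \<cdot> x\<close> with \<open>A\<close>
  in \<open>N\<close> exhaust the tangent space of the orbit at \<open>x\<close>.\<close>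

lemma exists_injective_if_loc:
  assumes L: "E.subspace L" "L \<subseteq> lin" "\<And>D E. D \<in> L \<Longrightarrow> E \<in> L \<Longrightarrow> commutator D E \<in> L"
    and \<Delta>: "\<Delta> \<in> loc L" "inj (app \<Delta>)"
  shows "\<exists>D\<in>L. inj (app D)"
proof (rule ccontr)
  assume "\<not> ?thesis"
  moreover have "inj (app D)" if "\<forall>x. D \<cdot> x = 0 \<longrightarrow> x = 0" for D
  proof (rule injI)
    fix x y assume "D \<cdot> x = D \<cdot> y"
    then have "D \<cdot> (x - y) = 0" by simp
    then have "x - y = 0" using that by blast
    then show "x = y" by simp
  qed
  ultimately have "\<exists>x. x \<noteq> 0 \<and> D \<cdot> x = 0" if "D \<in> L" for D using that by blast
  then obtain h x where h: "h \<in> L" and "x \<noteq> 0"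
    and kill: "\<And>D. D \<in> L \<Longrightarrow> D \<in> E.gen_eig (commutator h) 0 \<Longrightarrow> D \<cdot> x = 0"
    using exists_regular_pair[OF L] by blast
  have hlin: "h \<in> lin" using h L(2) by blast
  have "h \<in> E.gen_eig (commutator h) 0"
    by (rule E.gen_eigI[where k = 1]) (simp add: commutator_def)
  then have hx: "h \<cdot> x = 0" using kill h by blast
  define N0 where "N0 = {A \<in> L. \<exists>a. a \<noteq> 0 \<and> A \<in> E.gen_eig (commutator h) a}"
  have MN: "commutator D A \<in> loc L" if D: "D \<in> loc L" and A: "A \<in> E.span N0" for D A
  proof -
    have "D \<in> lin" using D by (simp add: loc_def)
    note lin = E.linearD[OF linear_commutator[OF this]] E.linear_zero[OF linear_commutator[OF this]]
    have "E.subspace {A. commutator D A \<in> loc L}"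
      using subspace_loc[OF L(1)]
      by (intro E.subspaceI) (auto simp: lin E.subspace_0 E.subspace_add E.subspace_scale)
    moreover have "N0 \<subseteq> {A. commutator D A \<in> loc L}"
    proof
      fix A assume "A \<in> N0"
      then obtain a where A: "A \<in> L" "a \<noteq> 0" "A \<in> E.gen_eig (commutator h) a"
        unfolding N0_def by blast
      then have "A ^ dimension = 0" using gen_eig_nilpotent[OF hlin] L(2) by blast
      then show "A \<in> {A. commutator D A \<in> loc L}"
        using loc_commutator_nilpotent[OF L A(1) _ D] by blast
    qed
    ultimately have "E.span N0 \<subseteq> {A. commutator D A \<in> loc L}" by (intro E.span_minimal)
    with A show ?thesis by blast
  qed
  have surj: "\<exists>A\<in>E.span N0. h \<cdot> A \<cdot> x = D \<cdot> x" if D: "D \<in> loc L" for D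
  proof -
    define Z where "Z = {B. \<exists>A\<in>E.span N0. h \<cdot> A \<cdot> x = B \<cdot> x}"
    have "E.subspace Z"
    proof (rule E.subspaceI)
      show "0 \<in> Z" unfolding Z_def by (intro CollectI bexI[of _ 0]) (auto simp: E.span_zero)
    next
      fix B C assume "B \<in> Z" "C \<in> Z"
      then obtain A A' where "A \<in> E.span N0" "A' \<in> E.span N0" "h \<cdot> A \<cdot> x = B \<cdot> x" "h \<cdot> A' \<cdot> x = C \<cdot> x"
        unfolding Z_def by blast
      then show "B + C \<in> Z" unfolding Z_def
        by (intro CollectI bexI[of _ "A + A'"]) (auto simp: E.span_add)
    next
      fix c B assume "B \<in> Z"
      then obtain A where "A \<in> E.span N0" "h \<cdot> A \<cdot> x = B \<cdot> x" unfolding Z_def by blast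
      then show "escale c B \<in> Z" unfolding Z_def
        by (intro CollectI bexI[of _ "escale c A"]) (auto simp: E.span_scale lin_scale[OF hlin])
    qed
    moreover have "B \<in> Z" if B: "B \<in> L" "B \<in> E.gen_eig (commutator h) c" for B c
    proof (cases "c = 0")
      case True
      then have "B \<cdot> x = 0" using kill B by blast
      then show ?thesis unfolding Z_def by (intro CollectI bexI[of _ 0]) (auto simp: E.span_zero)
    next
      case False
      have "\<exists>A\<in>L \<inter> E.gen_eig (commutator h) c. commutator h A - escale 0 A = B"
        by (rule E.gen_eig_shift_surj[OF linear_commutator[OF hlin] L(1) L(3)[OF h] B False])
      then obtain A where A: "A \<in> L" "A \<in> E.gen_eig (commutator h) c" "commutator h A = B" by auto
      then have "A \<in> E.span N0" using False by (auto simp: N0_def intro: E.span_base)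
      \<comment> \<open>As \<open>h\<close> kills \<open>x\<close>, \<open>commutator h A\<close>
        and \<open>h * A\<close> agree at \<open>x\<close>.\<close>
      moreover have "h \<cdot> A \<cdot> x = B \<cdot> x" using A(3) hx by (auto simp: app_commutator)
      ultimately show ?thesis unfolding Z_def by blast
    qed
    ultimately have "E.span (L \<inter> (\<Union>c. E.gen_eig (commutator h) c)) \<subseteq> Z" by (intro E.span_minimal) auto
    moreover obtain F where F: "finite F" "lin \<subseteq> E.span F" by (rule lin_subset_span)
    have "B \<in> E.span (L \<inter> (\<Union>c. E.gen_eig (commutator h) c))" if "B \<in> L" for B
      using F L(2) by (intro E.span_gen_eig[OF linear_commutator[OF hlin] L(1) L(3)[OF h] that F(1)]) auto
    moreover obtain B where "B \<in> L" "D \<cdot> x = B \<cdot> x" using D unfolding loc_def by blast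
    ultimately have "B \<in> Z" by blast
    then show ?thesis using \<open>D \<cdot> x = B \<cdot> x\<close> unfolding Z_def by simp
  qed
  have "h \<in> loc L" using subset_loc[OF L(2)] h by blast
  then obtain y where y: "y 0 = x" "\<And>k. h \<cdot> y (Suc k) = - (\<Delta> \<cdot> y k)"
    using formal_null_vector_sequence[OF _ hx \<Delta>(1) subspace_loc[OF L(1)] MN surj] by blast
  have \<Delta>lin: "Vector_Spaces.linear scale scale (app \<Delta>)" using \<Delta>(1) lin_linear by (auto simp: loc_def)
  define T where "T = (\<lambda>z. inv (app \<Delta>) (h \<cdot> z))"
  have inv: "Vector_Spaces.linear scale scale (inv (app \<Delta>))"
    by (rule inj_linear_imp_inv_linear[OF \<Delta>lin \<Delta>(2)])
  have "Vector_Spaces.linear scale scale T"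
    using inv hlin by (simp add: T_def Vector_Spaces.linear_iff lin_scale)
  moreover have "T (y 0) = 0" using hx y(1) linear_zero[OF inv] by (simp add: T_def)
  moreover have "T (y (Suc k)) = (- 1) *s y k" for k
    unfolding T_def y(2) linearD(4)[OF inv] using inv_f_f[OF \<Delta>(2)] by simp
  ultimately show False
    using no_infinite_preimage_chain[of T y "\<lambda>_. - 1"] \<open>x \<noteq> 0\<close> y(1) by simp
qed

lemma invertible_linear_iff_inj:
  "invertible_linear scale D \<longleftrightarrow> Vector_Spaces.linear scale scale D \<and> inj D"
proof
  assume "invertible_linear scale D"
  then show "Vector_Spaces.linear scale scale D \<and> inj D"
    unfolding invertible_linear_def by (metis inj_on_id inj_on_imageI2)
next
  assume D: "Vector_Spaces.linear scale scale D \<and> inj D"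
  then have "surj D" using linear_inj_imp_surj by blast
  then show "invertible_linear scale D" unfolding invertible_linear_def
    using D inj_linear_imp_inv_linear by (intro conjI exI[of _ "inv D"]) (auto simp: fun_eq_iff surj_f_inv_f)
qed

text \<open>The closure hypotheses make \<open>S\<close> a Lie algebra of linear maps. The lemma
  passes from functions to the type of additive endomorphisms and back.\<close>

lemma invertible_local_map_iff:
  assumes lin: "\<And>D. D \<in> S \<Longrightarrow> Vector_Spaces.linear scale scale D"
    and zero: "(\<lambda>_. 0) \<in> S" and add: "\<And>D E. D \<in> S \<Longrightarrow> E \<in> S \<Longrightarrow> (\<lambda>x. D x + E x) \<in> S"
    and scale: "\<And>c D. D \<in> S \<Longrightarrow> (\<lambda>x. c *s D x) \<in> S"
    and comm: "\<And>D E. D \<in> S \<Longrightarrow> E \<in> S \<Longrightarrow> (\<lambda>x. D (E x) - E (D x)) \<in> S"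
  shows "(\<exists>D\<in>local_maps scale S. invertible_linear scale D) \<longleftrightarrow> (\<exists>D\<in>S. invertible_linear scale D)"
proof
  assume "\<exists>D\<in>S. invertible_linear scale D"
  then show "\<exists>D\<in>local_maps scale S. invertible_linear scale D"
    using lin by (auto simp: local_maps_def)
next
  assume "\<exists>D\<in>local_maps scale S. invertible_linear scale D"
  then obtain \<Delta> where \<Delta>: "Vector_Spaces.linear scale scale \<Delta>" "inj \<Delta>" "\<And>x. \<exists>D\<in>S. \<Delta> x = D x"
    by (auto simp: local_maps_def invertible_linear_iff_inj)
  have app_Endo: "app (Endo D) = D" if "Vector_Spaces.linear scale scale D" for D
    using that by (intro Endo_inverse) (simp add: linearD)
  define L where "L = {D. app D \<in> S}"
  have ex: "\<exists>D\<in>L. inj (app D)"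
  proof (rule exists_injective_if_loc)
    have "app (0 :: 'a endo) = (\<lambda>_. 0)" "app (D + E) = (\<lambda>x. D \<cdot> x + E \<cdot> x)" "app (escale c D) = (\<lambda>x. c *s D \<cdot> x)"
      for D E c by (auto simp: fun_eq_iff)
    then show "E.subspace L" unfolding L_def
      using zero by (intro E.subspaceI) (auto intro: add scale)
    show "L \<subseteq> local.lin" using lin by (auto simp: L_def lin_iff_linear)
    show "commutator D E \<in> L" if "D \<in> L" "E \<in> L" for D E
    proof -
      have "app (commutator D E) = (\<lambda>x. D \<cdot> E \<cdot> x - E \<cdot> D \<cdot> x)" by (auto simp: fun_eq_iff app_commutator)
      then show ?thesis using that comm by (simp add: L_def)
    qed
    show "Endo \<Delta> \<in> loc L"
    proof -
      have "\<exists>E\<in>L. Endo \<Delta> \<cdot> x = E \<cdot> x" for x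
      proof -
        obtain D where "D \<in> S" "\<Delta> x = D x" using \<Delta>(3) by blast
        then show ?thesis using app_Endo[OF lin] app_Endo[OF \<Delta>(1)]
          by (intro bexI[of _ "Endo D"]) (auto simp: L_def)
      qed
      then show ?thesis using app_Endo[OF \<Delta>(1)] \<Delta>(1) by (simp add: loc_def lin_iff_linear)
    qed
    show "inj (app (Endo \<Delta>))" using app_Endo[OF \<Delta>(1)] \<Delta>(2) by simp
  qed
  then obtain D where "D \<in> L" "inj (app D)" by blast
  then show "\<exists>D\<in>S. invertible_linear scale D"
    using lin by (auto simp: L_def invertible_linear_iff_inj)
qed

end

section \<open>Spaces of Leibniz derivations as Lie algebras\<close>

context
  fixes smul :: "complex \<Rightarrow> 'a::ab_group_add \<Rightarrow> 'a" and mult :: "'a \<Rightarrow> 'a \<Rightarrow> 'a"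
  assumes algebra: "fin_dim_complex_algebra smul mult"
begin

lemma linear_mult:
  "Vector_Spaces.linear smul smul (mult x)" "Vector_Spaces.linear smul smul (\<lambda>x. mult x y)"
  using algebra by (auto simp: fin_dim_complex_algebra_def)

text \<open>Multilinearity of the bracketed product, on which the closure properties of
  \<open>LDer_arr\<close> below rest.\<close>

lemma linear_bracket_slot:
  assumes "length xs = slots f" "i < slots f"
  shows "Vector_Spaces.linear smul smul (\<lambda>x. bracket mult f (xs[i := x]))"
  using assms
proof (induction f arbitrary: xs i)
  case Slot
  then have "bracket mult Slot (xs[i := x]) = x" for x by (cases xs) auto
  moreover have "Vector_Spaces.linear smul smul (\<lambda>x. x)"
    using linear_mult(1) by (auto simp: Vector_Spaces.linear_iff)
  ultimately show ?case by simp
next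
  case (Br f g)
  show ?case
  proof (cases "i < slots f")
    case True
    have "Vector_Spaces.linear smul smul (\<lambda>x. bracket mult f ((take (slots f) xs)[i := x]))"
      using Br.prems True by (intro Br.IH(1)) auto
    then have "Vector_Spaces.linear smul smul (\<lambda>x. mult (bracket mult f ((take (slots f) xs)[i := x]))
        (bracket mult g (drop (slots f) xs)))"
      using linear_mult(2) by (simp add: Vector_Spaces.linear_iff)
    then show ?thesis using True by (simp add: take_update_swap)
  next
    case False
    have "Vector_Spaces.linear smul smul (\<lambda>x. bracket mult g ((drop (slots f) xs)[i - slots f := x]))"
      using Br.prems False by (intro Br.IH(2)) auto
    then have "Vector_Spaces.linear smul smul (\<lambda>x. mult (bracket mult f (take (slots f) xs))
        (bracket mult g ((drop (slots f) xs)[i - slots f := x])))"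
      using linear_mult(1) by (simp add: Vector_Spaces.linear_iff)
    then show ?thesis using False by (simp add: drop_update_swap)
  qed
qed

lemma LDer_arrD:
  assumes "D \<in> LDer_arr smul mult f"
  shows "Vector_Spaces.linear smul smul D"
    "length xs = slots f \<Longrightarrow>
      D (bracket mult f xs) = (\<Sum>i<slots f. bracket mult f (xs[i := D (xs ! i)]))"
  using assms by (auto simp: LDer_arr_def)

lemma LDer_arr_zero: "(\<lambda>_. 0) \<in> LDer_arr smul mult f"
proof -
  have lin0: "Vector_Spaces.linear smul smul (\<lambda>_. 0)"
    using linear_mult(1) by (auto simp: Vector_Spaces.linear_iff module.scale_zero_right
        module_iff_vector_space)
  have "bracket mult f (xs[i := 0]) = 0" if "length xs = slots f" "i < slots f" for xs i
    using linear_bracket_slot[OF that]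
    by (metis linear_iff_module_hom module_hom.zero)
  with lin0 show ?thesis by (simp add: LDer_arr_def)
qed

lemma LDer_arr_add:
  assumes D: "D \<in> LDer_arr smul mult f" and E: "E \<in> LDer_arr smul mult f"
  shows "(\<lambda>x. D x + E x) \<in> LDer_arr smul mult f"
proof -
  have "D (bracket mult f xs) + E (bracket mult f xs)
      = (\<Sum>i<slots f. bracket mult f (xs[i := D (xs ! i) + E (xs ! i)]))" if xs: "length xs = slots f" for xs
    unfolding LDer_arrD(2)[OF D xs] LDer_arrD(2)[OF E xs] sum.distrib[symmetric]
    using linear_bracket_slot[OF xs] by (intro sum.cong) (auto simp: Vector_Spaces.linear_iff)
  moreover have "Vector_Spaces.linear smul smul (\<lambda>x. D x + E x)"
    using LDer_arrD(1)[OF D] LDer_arrD(1)[OF E]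
    by (auto simp: Vector_Spaces.linear_iff add_ac vector_space.vector_space_assms(1))
  ultimately show ?thesis by (simp add: LDer_arr_def)
qed

lemma LDer_arr_scale:
  assumes D: "D \<in> LDer_arr smul mult f"
  shows "(\<lambda>x. smul c (D x)) \<in> LDer_arr smul mult f"
proof -
  interpret vector_space smul using LDer_arrD(1)[OF D] by (simp add: Vector_Spaces.linear_iff)
  have "smul c (D (bracket mult f xs))
      = (\<Sum>i<slots f. bracket mult f (xs[i := smul c (D (xs ! i))]))" if xs: "length xs = slots f" for xs
    unfolding LDer_arrD(2)[OF D xs] scale_sum_right
    using linear_bracket_slot[OF xs] by (intro sum.cong) (auto simp: Vector_Spaces.linear_iff)
  moreover have "Vector_Spaces.linear smul smul (\<lambda>x. smul c (D x))"
    using LDer_arrD(1)[OF D]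
    by (auto simp: Vector_Spaces.linear_iff scale_right_distrib mult.commute)
  ultimately show ?thesis by (simp add: LDer_arr_def)
qed

text \<open>In \<open>D E - E D\<close> the terms with \<open>D\<close> and \<open>E\<close> in
  different slots cancel; the remaining terms have the commutator in a single slot.\<close>

lemma LDer_arr_commutator:
  assumes D: "D \<in> LDer_arr smul mult f" and E: "E \<in> LDer_arr smul mult f"
  shows "(\<lambda>x. D (E x) - E (D x)) \<in> LDer_arr smul mult f"
proof -
  interpret vector_space smul using LDer_arrD(1)[OF D] by (simp add: Vector_Spaces.linear_iff)
  have lin: "Vector_Spaces.linear smul smul (\<lambda>x. D (E x) - E (D x))"
    using LDer_arrD(1)[OF D] LDer_arrD(1)[OF E]
    by (auto simp: Vector_Spaces.linear_iff scale_right_diff_distrib)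
  have twice: "D (E (bracket mult f xs)) = (\<Sum>i<slots f. \<Sum>j<slots f.
      bracket mult f (xs[i := E (xs ! i), j := D (xs[i := E (xs ! i)] ! j)]))"
    if D: "D \<in> LDer_arr smul mult f" and E: "E \<in> LDer_arr smul mult f" and xs: "length xs = slots f"
    for D E xs
    unfolding LDer_arrD(2)[OF E xs] linear_iff_module_hom[THEN iffD1, OF LDer_arrD(1)[OF D], THEN module_hom.sum]
    by (intro sum.cong refl LDer_arrD(2)[OF D]) (simp add: xs)
  have "D (E (bracket mult f xs)) - E (D (bracket mult f xs))
      = (\<Sum>i<slots f. bracket mult f (xs[i := D (E (xs ! i)) - E (D (xs ! i))]))"
    if xs: "length xs = slots f" for xs
  proof -
    \<comment> \<open>The inner lookup reads the updated list, so \<open>a i i\<close> contains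
      \<open>D (E (xs ! i))\<close> and not \<open>D (xs ! i)\<close>.\<close>
    define a where "a i j = bracket mult f (xs[i := E (xs ! i), j := D (xs[i := E (xs ! i)] ! j)])" for i j
    define b where "b i j = bracket mult f (xs[i := D (xs ! i), j := E (xs[i := D (xs ! i)] ! j)])" for i j
    have off_diagonal: "a i j = b j i" if "i \<noteq> j" for i j
      using that by (simp add: a_def b_def list_update_swap)
    have "D (E (bracket mult f xs)) - E (D (bracket mult f xs))
        = (\<Sum>i<slots f. \<Sum>j<slots f. a i j) - (\<Sum>i<slots f. \<Sum>j<slots f. b i j)"
      unfolding twice[OF D E xs] twice[OF E D xs] a_def b_def ..
    also have "(\<Sum>i<slots f. \<Sum>j<slots f. b i j) = (\<Sum>i<slots f. \<Sum>j<slots f. b j i)"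
      by (rule sum.swap)
    also have "(\<Sum>i<slots f. \<Sum>j<slots f. a i j) - (\<Sum>i<slots f. \<Sum>j<slots f. b j i)
        = (\<Sum>i<slots f. \<Sum>j<slots f. if j = i then a i i - b i i else 0)"
      unfolding sum_subtractf[symmetric] by (intro sum.cong refl) (auto simp: off_diagonal)
    also have "\<dots> = (\<Sum>i<slots f. a i i - b i i)"
      by (intro sum.cong refl) simp
    also have "\<dots> = (\<Sum>i<slots f. bracket mult f (xs[i := D (E (xs ! i)) - E (D (xs ! i))]))"
    proof (intro sum.cong refl)
      fix i assume "i \<in> {..<slots f}"
      then have i: "i < slots f" by simp
      have "module_hom smul smul (\<lambda>x. bracket mult f (xs[i := x]))"
        using linear_bracket_slot[OF xs i] by (simp add: linear_iff_module_hom)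
      from module_hom.diff[OF this] show "a i i - b i i
          = bracket mult f (xs[i := D (E (xs ! i)) - E (D (xs ! i))])"
        using i xs by (simp add: a_def b_def)
    qed
    finally show ?thesis .
  qed
  with lin show ?thesis by (simp add: LDer_arr_def)
qed

lemma LocLDer_arr_invertible_iff:
  "(\<exists>D\<in>LocLDer_arr smul mult f. invertible_linear smul D) \<longleftrightarrow>
   (\<exists>D\<in>LDer_arr smul mult f. invertible_linear smul D)"
proof -
  obtain B where "finite_dimensional_vector_space smul B"
    using algebra by (auto simp: fin_dim_complex_algebra_def)
  then interpret fin_dim_complex_space smul B by (simp add: fin_dim_complex_space_def)
  show ?thesis unfolding LocLDer_arr_def
    by (rule invertible_local_map_iff)
      (auto intro: LDer_arrD(1) LDer_arr_zero LDer_arr_add LDer_arr_scale LDer_arr_commutator)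
qed

lemma LocLDer_ord_invertible_iff:
  assumes "n \<ge> 1"
  shows "(\<exists>D\<in>LocLDer_ord smul mult n. invertible_linear smul D) \<longleftrightarrow>
    (\<exists>D\<in>LDer_ord smul mult n. invertible_linear smul D)"
proof -
  obtain B where "finite_dimensional_vector_space smul B"
    using algebra by (auto simp: fin_dim_complex_algebra_def)
  then interpret fin_dim_complex_space smul B by (simp add: fin_dim_complex_space_def)
  \<comment> \<open>A nonempty set of arrangements guarantees that members of the intersection are
    linear.\<close>
  have "left_arrangement n \<in> arrangements n"
    using assms by (simp add: arrangements_def slots_left_arrangement)
  then show ?thesis unfolding LocLDer_ord_def LDer_ord_def
    by (intro invertible_local_map_iff)
      (auto intro: LDer_arrD(1) LDer_arr_zero LDer_arr_add LDer_arr_scale LDer_arr_commutator)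
qed

end

theorem theorem2p22:
  fixes smul :: "complex \<Rightarrow> 'a::ab_group_add \<Rightarrow> 'a"
    and mult :: "'a \<Rightarrow> 'a \<Rightarrow> 'a"
    and n :: nat
  assumes "fin_dim_complex_algebra smul mult"
    and "n \<ge> 2"
  shows "(\<forall>f\<in>arrangements n.
            (\<exists>D\<in>LocLDer_arr smul mult f. invertible_linear smul D) \<longleftrightarrow>
            (\<exists>D\<in>LDer_arr smul mult f. invertible_linear smul D)) \<and>
         ((\<exists>D\<in>LocLDer_arr smul mult (left_arrangement n). invertible_linear smul D) \<longleftrightarrow>
          (\<exists>D\<in>LDer_arr smul mult (left_arrangement n). invertible_linear smul D)) \<and>
         ((\<exists>D\<in>LocLDer_arr smul mult (right_arrangement n). invertible_linear smul D) \<longleftrightarrow>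
          (\<exists>D\<in>LDer_arr smul mult (right_arrangement n). invertible_linear smul D)) \<and>
         ((\<exists>D\<in>LocLDer_ord smul mult n. invertible_linear smul D) \<longleftrightarrow>
          (\<exists>D\<in>LDer_ord smul mult n. invertible_linear smul D)) \<and>
         ((\<exists>D\<in>LocLDer_left smul mult. invertible_linear smul D) \<longleftrightarrow>
          (\<exists>D\<in>LDer_left smul mult. invertible_linear smul D)) \<and>
         ((\<exists>D\<in>LocLDer_right smul mult. invertible_linear smul D) \<longleftrightarrow>
          (\<exists>D\<in>LDer_right smul mult. invertible_linear smul D)) \<and>
         ((\<exists>D\<in>LocLDer smul mult. invertible_linear smul D) \<longleftrightarrow>
          (\<exists>D\<in>LDer smul mult. invertible_linear smul D))"
  \<comment> \<open>Without a prescribed order, the unions turn the existence of an invertible map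
    into the existence of an order, at which the equivalence for that order applies.\<close>
  using assms(2)
  by (auto simp: LocLDer_left_def LDer_left_def LocLDer_right_def LDer_right_def LocLDer_def LDer_def
      LocLDer_arr_invertible_iff[OF assms(1)] LocLDer_ord_invertible_iff[OF assms(1)])

end
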